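(* Let $\varphi:\mathcal A\to\widetilde{\mathcal A}$ be a faithful functor between small categories, and let $\widetilde G$ be a crossed $\widetilde{\mathcal A}$-group such that $\varphi$ is $\widetilde G$-stable. Then the adjunctions $\varphi^{\widetilde G}_\flat\dashv\varphi^\natural_{\widetilde G}\dashv\varphi^{\widetilde G}_\sharp$ between $\mathbf{CrsMon}^{/\varphi^\ast\widetilde G}_{\mathcal A}$ and $\mathbf{CrsMon}^{/\widetilde G}_{\widetilde{\mathcal A}}$, where $$\varphi^{\widetilde G}_\flat,\ \varphi^{\widetilde G}_\sharp:\mathbf{CrsMon}^{/\varphi^\ast\widetilde G}_{\mathcal A}\to\mathbf{CrsMon}^{/\widetilde G}_{\widetilde{\mathcal A}},\qquad \varphi^\natural_{\widetilde G}:\mathbf{CrsMon}^{/\widetilde G}_{\widetilde{\mathcal A}}\to\mathbf{CrsMon}^{/\varphi^\ast\widetilde G}_{\mathcal A},$$ restrict to adjunctions $\varphi^{\widetilde G}_\flat\dashv\varphi^\natural_{\widetilde G}\dashv\varphi^{\widetilde G}_\sharp$ between the full subcategories $\mathbf{CrsGrp}^{/\varphi^\ast\widetilde G}_{\mathcal A}$ and $\mathbf{CrsGrp}^{/\widetilde G}_{\widetilde{\mathcal A}}$. Moreover, if $\varphi$ is fully faithful, then so are $\varphi^{\widetilde G}_\flat$ and $\varphi^{\widetilde G}_\sharp$, even after restriction to crossed groups.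
   Context: **Crossed groups.** Let $\mathcal A$ be a small category. An $\mathcal A$-set is a presheaf of sets on $\mathcal A$; they form $\mathbf{Set}_{\mathcal A}$. A crossed $\mathcal A$-group is an $\mathcal A$-set $G$ together with a group structure on each $G(a)$ and a left action $G(b)\times\mathcal A(a,b)\to\mathcal A(a,b)$, $(x,f)\mapsto f^x$, of the group $G(b)$ for all $a,b$, such that: (i) $(gf)^x=g^xf^{g^\ast(x)}$ for $f:a\to b$, $g:b\to c$, $x\in G(c)$; (ii) $f^\ast(xy)=(f^y)^\ast(x)f^\ast(y)$ for $f:a\to b$, $x,y\in G(b)$. A map of crossed $\mathcal A$-groups is a map of $\mathcal A$-sets which is degreewise a group homomorphism and respects the actions on the $\mathcal A(a,b)$. The category $\mathbf{CrsGrp}_{\mathcal A}$ has a terminal object $\mathfrak T_{\mathcal A}$; $\mathbf{CrsGrp}^{/G}_{\mathcal A}$ is its slice over $G$. **Crossed monoids.** For a crossed $\mathcal A$-group $G$, $\mathbf{Set}^{/G}_{\mathcal A}$ is the category of $\mathcal A$-sets over $G$. For $p:X\to G$, $x\in X(b)$, $f:a\to b$, write $f^x:=f^{p(x)}$. It is monoidal under $\rtimes_G$: for $p:X\to G$, $q:Y\to G$, $(X\rtimes_G Y)(a)=X(a)\times Y(a)$, $f^\ast(x,y)=((f^y)^\ast(x),f^\ast(y))$, with structure map $(x,y)\mapsto p(x)q(y)$; the unit is the terminal $\mathcal A$-set with the unit map to $G$. $\mathbf{CrsMon}_{\mathcal A}$ is the category of monoid objects in $(\mathbf{Set}^{/\mathfrak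 T_{\mathcal A}}_{\mathcal A},\rtimes_{\mathfrak T_{\mathcal A}})$ (crossed $\mathcal A$-monoids); crossed $\mathcal A$-groups are crossed $\mathcal A$-monoids via their degreewise multiplication. The slice $\mathbf{CrsMon}^{/G}_{\mathcal A}$ is canonically equivalent to the category of monoid objects in $(\mathbf{Set}^{/G}_{\mathcal A},\rtimes_G)$, and contains $\mathbf{CrsGrp}^{/G}_{\mathcal A}$ as the full subcategory of those objects that are degreewise groups. **Base change.** A faithful functor $\varphi:\mathcal A\to\widetilde{\mathcal A}$ between small categories is $\widetilde G$-stable, for a crossed $\widetilde{\mathcal A}$-group $\widetilde G$, if for all $a,b\in\mathcal A$ the image of $\varphi:\mathcal A(a,b)\to\widetilde{\mathcal A}(\varphi(a),\varphi(b))$ is stable under the action of $\widetilde G(\varphi(b))$. Then $\varphi^\ast\widetilde G=\widetilde G\circ\varphi$ has a unique structure of crossed $\mathcal A$-group with the same degreewise group structures and for which the maps $\varphi:\mathcal A(a,b)\to\widetilde{\mathcal A}(\varphi(a),\varphi(b))$ are $\widetilde G(\varphi(b))$-equivariant. The restriction functor $\varphi^\ast_{\widetilde G}:\mathbf{Set}^{/\widetilde G}_{\widetilde{\mathcal A}}\to\mathbf{Set}^{/\varphi^\ast\widetilde G}_{\mathcal A}$, $\widetilde X\mapsto\widetilde X\circ\varphi$, is monoidal with respect to $\rtimes_{\widetilde G}$ and $\rtimes_{\varphi^\ast\widetilde G}$, and $\varphi^\natural_{\widetilde G}:\mathbf{CrsMon}^{/\widetilde G}_{\widetilde{\mathcal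 A}}\to\mathbf{CrsMon}^{/\varphi^\ast\widetilde G}_{\mathcal A}$ is the functor it induces on monoid objects. This functor has a left adjoint, denoted $\varphi^{\widetilde G}_\flat$, and a right adjoint, denoted $\varphi^{\widetilde G}_\sharp$. *)

theory Defs
  imports "HOL-Algebra.Group_Action" "HOL-Library.Equipollence"
begin

section \<open>Categories, functors, adjunctions\<close>

record ('o, 'm) cat =
  Ob :: "'o set"
  Ar :: "'m set"
  Dom :: "'m \<Rightarrow> 'o"
  Cod :: "'m \<Rightarrow> 'o"
  Ide :: "'o \<Rightarrow> 'm"
  Comp :: "'m \<Rightarrow> 'm \<Rightarrow> 'm"  \<comment> \<open>\<open>Comp C g f\<close> is \<open>g\<close> after \<open>f\<close>\<close>

definition Hom :: "('o, 'm) cat \<Rightarrow> 'o \<Rightarrow> 'o \<Rightarrow> 'm set" where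
  "Hom C a b = {f \<in> Ar C. Dom C f = a \<and> Cod C f = b}"

locale category =
  fixes C :: "('o, 'm) cat"
  assumes Dom_Ob: "f \<in> Ar C \<Longrightarrow> Dom C f \<in> Ob C"
    and Cod_Ob: "f \<in> Ar C \<Longrightarrow> Cod C f \<in> Ob C"
    and Ide_Hom: "a \<in> Ob C \<Longrightarrow> Ide C a \<in> Hom C a a"
    and Comp_Hom: "f \<in> Hom C a b \<Longrightarrow> g \<in> Hom C b c \<Longrightarrow> Comp C g f \<in> Hom C a c"
    and Comp_Ide: "f \<in> Hom C a b \<Longrightarrow> Comp C f (Ide C a) = f"
    and Ide_Comp: "f \<in> Hom C a b \<Longrightarrow> Comp C (Ide C b) f = f"
    and Comp_assoc: "f \<in> Hom C a b \<Longrightarrow> g \<in> Hom C b c \<Longrightarrow> h \<in> Hom C c d \<Longrightarrow>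
      Comp C h (Comp C g f) = Comp C (Comp C h g) f"

definition full_subcat :: "('o, 'm) cat \<Rightarrow> 'o set \<Rightarrow> ('o, 'm) cat" where
  "full_subcat C S = C \<lparr> Ob := Ob C \<inter> S, Ar := {f \<in> Ar C. Dom C f \<in> S \<and> Cod C f \<in> S} \<rparr>"

record ('o1, 'm1, 'o2, 'm2) funct =
  FOb :: "'o1 \<Rightarrow> 'o2"
  FAr :: "'m1 \<Rightarrow> 'm2"

locale is_functor =
  fixes C :: "('o1, 'm1) cat" and D :: "('o2, 'm2) cat" and F :: "('o1, 'm1, 'o2, 'm2) funct"
  assumes FOb_Ob: "a \<in> Ob C \<Longrightarrow> FOb F a \<in> Ob D"
    and FAr_Hom: "f \<in> Hom C a b \<Longrightarrow> FAr F f \<in> Hom D (FOb F a) (FOb F b)"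
    and FAr_Ide: "a \<in> Ob C \<Longrightarrow> FAr F (Ide C a) = Ide D (FOb F a)"
    and FAr_Comp: "f \<in> Hom C a b \<Longrightarrow> g \<in> Hom C b c \<Longrightarrow>
      FAr F (Comp C g f) = Comp D (FAr F g) (FAr F f)"

definition faithful ::
  "('o1, 'm1) cat \<Rightarrow> ('o1, 'm1, 'o2, 'm2) funct \<Rightarrow> bool" where
  "faithful C F \<longleftrightarrow> (\<forall>a\<in>Ob C. \<forall>b\<in>Ob C. inj_on (FAr F) (Hom C a b))"

definition fully_faithful ::
  "('o1, 'm1) cat \<Rightarrow> ('o2, 'm2) cat \<Rightarrow> ('o1, 'm1, 'o2, 'm2) funct \<Rightarrow> bool" where
  "fully_faithful C D F \<longleftrightarrow>
    (\<forall>a\<in>Ob C. \<forall>b\<in>Ob C. bij_betw (FAr F) (Hom C a b) (Hom D (FOb F a) (FOb F b)))"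

text \<open>\<open>L : C \<rightarrow> D\<close> is left adjoint to \<open>R : D \<rightarrow> C\<close>, with unit \<open>\<eta>\<close> and counit \<open>\<epsilon>\<close>. Functors and
  transformations only matter on the objects and arrows of their source, so the very same
  \<open>L\<close>, \<open>R\<close>, \<open>\<eta>\<close>, \<open>\<epsilon>\<close> can be asked to form an adjunction between subcategories of \<open>C\<close> and \<open>D\<close>.\<close>

locale adjunction =
  fixes C :: "('o1, 'm1) cat" and D :: "('o2, 'm2) cat"
    and L :: "('o1, 'm1, 'o2, 'm2) funct" and R :: "('o2, 'm2, 'o1, 'm1) funct"
    and \<eta> :: "'o1 \<Rightarrow> 'm1" and \<epsilon> :: "'o2 \<Rightarrow> 'm2"
  assumes L_functor: "is_functor C D L"
    and R_functor: "is_functor D C R"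
    and unit_Hom: "a \<in> Ob C \<Longrightarrow> \<eta> a \<in> Hom C a (FOb R (FOb L a))"
    and unit_natural: "f \<in> Hom C a b \<Longrightarrow>
      Comp C (\<eta> b) f = Comp C (FAr R (FAr L f)) (\<eta> a)"
    and counit_Hom: "x \<in> Ob D \<Longrightarrow> \<epsilon> x \<in> Hom D (FOb L (FOb R x)) x"
    and counit_natural: "g \<in> Hom D x y \<Longrightarrow>
      Comp D g (\<epsilon> x) = Comp D (\<epsilon> y) (FAr L (FAr R g))"
    and triangle_L: "a \<in> Ob C \<Longrightarrow> Comp D (\<epsilon> (FOb L a)) (FAr L (\<eta> a)) = Ide D (FOb L a)"
    and triangle_R: "x \<in> Ob D \<Longrightarrow> Comp C (FAr R (\<epsilon> x)) (\<eta> (FOb R x)) = Ide C (FOb R x)"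


section \<open>Presheaves and crossed groups\<close>

text \<open>A small category is one whose objects and arrows form sets of HOL types; the category of sets
  is played by the subsets of a type \<open>'u\<close>. To have the (co)limits indexed by a small category \<open>A\<close>
  available in it, \<open>'u\<close> has to be infinite and closed under \<open>Ar A\<close>-indexed powers. (Such a \<open>'u\<close> then
  also admits injections from \<open>'u list\<close>, from \<open>Ar A \<times> 'u\<close>, and so on, so that the Kan extensions and
  free monoids from which the base change adjoints are built exist in it.) Every \<open>A\<close> with arrows
  in \<open>'m\<close> has such types, for instance \<open>'m \<times> nat \<Rightarrow> 'v\<close> when \<open>'v\<close> has at least two elements.\<close>

definition closed_universe :: "'u itself \<Rightarrow> ('o, 'm) cat \<Rightarrow> bool" where
  "closed_universe _ A \<longleftrightarrow>
    infinite (UNIV :: 'u set) \<and> (Ar A \<rightarrow>\<^sub>E (UNIV :: 'u set)) \<lesssim> (UNIV :: 'u set)"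

record ('o, 'm, 'u) psh =
  Val :: "'o \<Rightarrow> 'u set"
  Res :: "'m \<Rightarrow> 'u \<Rightarrow> 'u"

locale presheaf =
  fixes A :: "('o, 'm) cat" and X :: "('o, 'm, 'u, 'z) psh_scheme"
  assumes Res_Val: "f \<in> Hom A a b \<Longrightarrow> x \<in> Val X b \<Longrightarrow> Res X f x \<in> Val X a"
    and Res_Ide: "a \<in> Ob A \<Longrightarrow> x \<in> Val X a \<Longrightarrow> Res X (Ide A a) x = x"
    and Res_Comp: "f \<in> Hom A a b \<Longrightarrow> g \<in> Hom A b c \<Longrightarrow> x \<in> Val X c \<Longrightarrow>
      Res X (Comp A g f) x = Res X f (Res X g x)"

definition psh_map :: "('o, 'm) cat \<Rightarrow> ('o, 'm, 'u, 'y) psh_scheme \<Rightarrow> ('o, 'm, 'v, 'z) psh_scheme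
    \<Rightarrow> ('o \<Rightarrow> 'u \<Rightarrow> 'v) \<Rightarrow> bool" where
  "psh_map A X Y h \<longleftrightarrow>
    (\<forall>a\<in>Ob A. h a \<in> Val X a \<rightarrow> Val Y a) \<and>
    (\<forall>a b. \<forall>f\<in>Hom A a b. \<forall>x\<in>Val X b. h a (Res X f x) = Res Y f (h b x))"

text \<open>\<open>Act G x f\<close> is \<open>f\<^sup>x\<close>; it is meaningful for \<open>x \<in> Val G (Cod A f)\<close>.\<close>

record ('o, 'm, 'u) crs_grp = "('o, 'm, 'u) psh" +
  GMul :: "'o \<Rightarrow> 'u \<Rightarrow> 'u \<Rightarrow> 'u"
  GOne :: "'o \<Rightarrow> 'u"
  Act :: "'u \<Rightarrow> 'm \<Rightarrow> 'm"

definition Gp :: "('o, 'm, 'u) crs_grp \<Rightarrow> 'o \<Rightarrow> 'u monoid" where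
  "Gp G a = \<lparr> carrier = Val G a, mult = GMul G a, one = GOne G a \<rparr>"

locale crossed_group = presheaf A G
  for A :: "('o, 'm) cat" and G :: "('o, 'm, 'u) crs_grp" +
  assumes Gp_group: "a \<in> Ob A \<Longrightarrow> group (Gp G a)"
    and Act_action: "a \<in> Ob A \<Longrightarrow> b \<in> Ob A \<Longrightarrow>
      group_action (Gp G b) (Hom A a b) (\<lambda>x. restrict (Act G x) (Hom A a b))"
    and Act_Comp: "f \<in> Hom A a b \<Longrightarrow> g \<in> Hom A b c \<Longrightarrow> x \<in> Val G c \<Longrightarrow>
      Act G x (Comp A g f) = Comp A (Act G x g) (Act G (Res G g x) f)"
    and Res_GMul: "f \<in> Hom A a b \<Longrightarrow> x \<in> Val G b \<Longrightarrow> y \<in> Val G b \<Longrightarrow>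
      Res G f (GMul G b x y) = GMul G a (Res G (Act G y f) x) (Res G f y)"

definition crs_grp_map :: "('o, 'm) cat \<Rightarrow> ('o, 'm, 'u) crs_grp \<Rightarrow> ('o, 'm, 'v) crs_grp
    \<Rightarrow> ('o \<Rightarrow> 'u \<Rightarrow> 'v) \<Rightarrow> bool" where
  "crs_grp_map A H G h \<longleftrightarrow> psh_map A H G h \<and>
    (\<forall>a\<in>Ob A. h a \<in> hom (Gp H a) (Gp G a)) \<and>
    (\<forall>a b. \<forall>f\<in>Hom A a b. \<forall>x\<in>Val H b. Act G (h b x) f = Act H x f)"


section \<open>Crossed monoids over a crossed group\<close>

record ('o, 'm, 'u, 'g) over = "('o, 'm, 'u) psh" +
  Str :: "'o \<Rightarrow> 'u \<Rightarrow> 'g"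

definition over_obj :: "('o, 'm) cat \<Rightarrow> ('o, 'm, 'g) crs_grp \<Rightarrow>
    ('o, 'm, 'u, 'g, 'z) over_scheme \<Rightarrow> bool" where
  "over_obj A G X \<longleftrightarrow> presheaf A X \<and> psh_map A X G (Str X)"

definition over_map :: "('o, 'm) cat \<Rightarrow> ('o, 'm, 'u, 'g, 'y) over_scheme \<Rightarrow>
    ('o, 'm, 'v, 'g, 'z) over_scheme \<Rightarrow> ('o \<Rightarrow> 'u \<Rightarrow> 'v) \<Rightarrow> bool" where
  "over_map A X Y h \<longleftrightarrow> psh_map A X Y h \<and> (\<forall>a\<in>Ob A. \<forall>x\<in>Val X a. Str Y a (h a x) = Str X a x)"

definition crs_prod :: "('o, 'm) cat \<Rightarrow> ('o, 'm, 'g) crs_grp \<Rightarrow> ('o, 'm, 'u, 'g, 'y) over_scheme \<Rightarrow>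
    ('o, 'm, 'v, 'g, 'z) over_scheme \<Rightarrow> ('o, 'm, 'u \<times> 'v, 'g) over" where
  "crs_prod A G X Y =
    \<lparr> Val = (\<lambda>a. Val X a \<times> Val Y a),
      Res = (\<lambda>f (x, y). (Res X (Act G (Str Y (Cod A f) y) f) x, Res Y f y)),
      Str = (\<lambda>a (x, y). GMul G a (Str X a x) (Str Y a y)) \<rparr>"

definition crs_unit :: "('o, 'm, 'g) crs_grp \<Rightarrow> ('o, 'm, unit, 'g) over" where
  "crs_unit G = \<lparr> Val = (\<lambda>a. {()}), Res = (\<lambda>f x. x), Str = (\<lambda>a x. GOne G a) \<rparr>"

record ('o, 'm, 'u, 'g) crs_mon = "('o, 'm, 'u, 'g) over" +
  Mul :: "'o \<Rightarrow> 'u \<Rightarrow> 'u \<Rightarrow> 'u"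
  One :: "'o \<Rightarrow> 'u"

definition Mn :: "('o, 'm, 'u, 'g) crs_mon \<Rightarrow> 'o \<Rightarrow> 'u monoid" where
  "Mn M a = \<lparr> carrier = Val M a, mult = Mul M a, one = One M a \<rparr>"

text \<open>Monoid objects for the product \<open>crs_prod\<close>. Its associativity and unit constraints are degreewise
  \<open>((x, y), z) \<mapsto> (x, (y, z))\<close>, \<open>((), x) \<mapsto> x\<close> and \<open>(x, ()) \<mapsto> x\<close>, so the monoid diagrams are the
  monoid laws in each degree.\<close>

definition mon_obj :: "('o, 'm) cat \<Rightarrow> ('o, 'm, 'g) crs_grp \<Rightarrow> ('o, 'm, 'u, 'g) crs_mon \<Rightarrow> bool" where
  "mon_obj A G M \<longleftrightarrow> over_obj A G M \<and>
    over_map A (crs_prod A G M M) M (\<lambda>a (x, y). Mul M a x y) \<and>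
    over_map A (crs_unit G) M (\<lambda>a _. One M a) \<and>
    (\<forall>a\<in>Ob A. monoid (Mn M a))"

definition mon_map :: "('o, 'm) cat \<Rightarrow> ('o, 'm, 'u, 'g) crs_mon \<Rightarrow> ('o, 'm, 'u, 'g) crs_mon \<Rightarrow>
    ('o \<Rightarrow> 'u \<Rightarrow> 'u) \<Rightarrow> bool" where
  "mon_map A M N h \<longleftrightarrow> over_map A M N h \<and>
    (\<forall>a\<in>Ob A. h a \<in> hom (Mn M a) (Mn N a) \<and> h a (One M a) = One N a)"

text \<open>Crossed monoids over \<open>G\<close>, as the monoid objects among the presheaves over \<open>G\<close>. Arrows carry
  their source and target, and are required to be \<open>undefined\<close> outside the relevant sets so that
  equality of arrows is equality of maps.\<close>

type_synonym ('o, 'm, 'u, 'g) crs_mon_arr =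
  "('o, 'm, 'u, 'g) crs_mon \<times> ('o \<Rightarrow> 'u \<Rightarrow> 'u) \<times> ('o, 'm, 'u, 'g) crs_mon"

definition CrsMon :: "('o, 'm) cat \<Rightarrow> ('o, 'm, 'g) crs_grp \<Rightarrow>
    (('o, 'm, 'u, 'g) crs_mon, ('o, 'm, 'u, 'g) crs_mon_arr) cat" where
  "CrsMon A G =
    \<lparr> Ob = {M. mon_obj A G M},
      Ar = {(M, h, N). mon_obj A G M \<and> mon_obj A G N \<and> mon_map A M N h \<and>
              h \<in> (\<Pi>\<^sub>E a\<in>Ob A. Val M a \<rightarrow>\<^sub>E Val N a)},
      Dom = (\<lambda>(M, h, N). M),
      Cod = (\<lambda>(M, h, N). N),
      Ide = (\<lambda>M. (M, \<lambda>a\<in>Ob A. \<lambda>x\<in>Val M a. x, M)),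
      Comp = (\<lambda>(N', k, P) (M, h, N). (M, \<lambda>a\<in>Ob A. \<lambda>x\<in>Val M a. k a (h a x), P)) \<rparr>"

definition CrsGrp :: "('o, 'm) cat \<Rightarrow> ('o, 'm, 'g) crs_grp \<Rightarrow>
    (('o, 'm, 'u, 'g) crs_mon, ('o, 'm, 'u, 'g) crs_mon_arr) cat" where
  "CrsGrp A G = full_subcat (CrsMon A G) {M. \<forall>a\<in>Ob A. group (Mn M a)}"


text \<open>The objects of \<open>CrsGrp A G\<close> are exactly the crossed groups equipped with a map of crossed
  groups to \<open>G\<close>, whose action is necessarily \<open>f\<^sup>x = f\<^bsup>p(x)\<^esup>\<close>; its arrows are the maps of crossed groups
  over \<open>G\<close>.\<close>

definition crs_grp_of :: "('o, 'm) cat \<Rightarrow> ('o, 'm, 'g) crs_grp \<Rightarrow> ('o, 'm, 'u, 'g) crs_mon \<Rightarrow>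
    ('o, 'm, 'u) crs_grp" where
  "crs_grp_of A G M =
    \<lparr> Val = Val M, Res = Res M, GMul = Mul M, GOne = One M,
      Act = (\<lambda>x f. Act G (Str M (Cod A f) x) f) \<rparr>"

lemma Gp_sel[simp]: "carrier (Gp G a) = Val G a" "mult (Gp G a) = GMul G a" "one (Gp G a) = GOne G a"
  by (auto simp: Gp_def)
lemma Mn_sel[simp]: "carrier (Mn G a) = Val G a" "mult (Mn G a) = Mul G a" "one (Mn G a) = One G a"
  by (auto simp: Mn_def)

lemma HomD: "category A \<Longrightarrow> f \<in> Hom A a b \<Longrightarrow> a \<in> Ob A \<and> b \<in> Ob A \<and> Dom A f = a \<and> Cod A f = b"
  unfolding Hom_def by (auto dest: category.Dom_Ob category.Cod_Ob)

lemma actI: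
  assumes "group G" "\<And>x f. x \<in> carrier G \<Longrightarrow> f \<in> E \<Longrightarrow> act x f \<in> E"
   "\<And>f. f \<in> E \<Longrightarrow> act \<one>\<^bsub>G\<^esub> f = f"
   "\<And>x y f. x \<in> carrier G \<Longrightarrow> y \<in> carrier G \<Longrightarrow> f \<in> E \<Longrightarrow> act (x \<otimes>\<^bsub>G\<^esub> y) f = act x (act y f)"
  shows "group_action G E (\<lambda>x. restrict (act x) E)"
proof -
  interpret group G by fact
  have bij: "bij_betw (act x) E E" if "x \<in> carrier G" for x
    apply (rule bij_betw_byWitness[where f' = "act (inv\<^bsub>G\<^esub> x)"])
    using that assms by (auto simp flip: assms(4))
  show ?thesis
    unfolding group_action_def group_hom_def group_hom_axioms_def
    apply (intro conjI assms group_BijGroup)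
    apply (auto simp: hom_def BijGroup_def Bij_def bij compose_def bij_betw_restrict_eq assms)
    done
qed

lemma actD:
  assumes "group_action G E (\<lambda>x. restrict (act x) E)"
  shows "x \<in> carrier G \<Longrightarrow> f \<in> E \<Longrightarrow> act x f \<in> E"
   "f \<in> E \<Longrightarrow> act \<one>\<^bsub>G\<^esub> f = f"
   "x \<in> carrier G \<Longrightarrow> y \<in> carrier G \<Longrightarrow> f \<in> E \<Longrightarrow> act (x \<otimes>\<^bsub>G\<^esub> y) f = act x (act y f)"
proof -
  interpret group_action G E "\<lambda>x. restrict (act x) E" by fact
  show 1: "x \<in> carrier G \<Longrightarrow> f \<in> E \<Longrightarrow> act x f \<in> E" for x
    using element_image by fastforce
  show "f \<in> E \<Longrightarrow> act \<one>\<^bsub>G\<^esub> f = f"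
    using id_eq_one by (metis restrict_apply)
  show "x \<in> carrier G \<Longrightarrow> y \<in> carrier G \<Longrightarrow> f \<in> E \<Longrightarrow> act (x \<otimes>\<^bsub>G\<^esub> y) f = act x (act y f)"
    using composition_rule[of f x y] 1 by simp
qed


theorem CrsGrp_Ob_iff:
  assumes "category A" "crossed_group A G"
  shows "M \<in> Ob (CrsGrp A G) \<longleftrightarrow>
   crossed_group A (crs_grp_of A G M) \<and> crs_grp_map A (crs_grp_of A G M) G (Str M)"
proof -
  interpret A: category A by fact
  interpret G: crossed_group A G by fact
  let ?H = "crs_grp_of A G M"
  note AD = HomD[OF assms(1)]
  have gact: "x \<in> Val G b \<Longrightarrow> Act G x f \<in> Hom A a b" "Act G (GOne G b) f = f"
    "x \<in> Val G b \<Longrightarrow> y \<in> Val G b \<Longrightarrow> Act G (GMul G b x y) f = Act G x (Act G y f)"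
    if "f \<in> Hom A a b" for f a b x y
    using actD[OF G.Act_action, of a b] that AD[OF that(1)] by auto
  have [simp]: "Val ?H = Val M" "Res ?H = Res M" "Gp ?H = Mn M" "GMul ?H = Mul M"
    by (auto simp: crs_grp_of_def Gp_def Mn_def)
  have A[simp]: "Act ?H x f = Act G (Str M b x) f" if "f \<in> Hom A a b" for a b x f
     using AD[OF that] by (auto simp: crs_grp_of_def)
  have [simp]: "presheaf A ?H = presheaf A M" "psh_map A ?H G = psh_map A M G" by (auto simp: presheaf_def psh_map_def)
  show ?thesis
  proof
    assume "M \<in> Ob (CrsGrp A G)"
    then have M: "mon_obj A G M" and gr: "\<And>a. a \<in> Ob A \<Longrightarrow> group (Mn M a)"
      by (auto simp: CrsGrp_def CrsMon_def full_subcat_def)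
    have p: "presheaf A M" "psh_map A M G (Str M)" using M by (auto simp: mon_obj_def over_obj_def)
    have S: "Str M a x \<in> Val G a" if "a \<in> Ob A" "x \<in> Val M a" for a x
      using p that by (auto simp: psh_map_def)
    have prod: "over_map A (crs_prod A G M M) M (\<lambda>a (x, y). Mul M a x y)"
      and unit: "over_map A (crs_unit G) M (\<lambda>a _. One M a)"
      using M by (auto simp: mon_obj_def)
    have 1: "Mul M a x y \<in> Val M a" "Str M a (Mul M a x y) = GMul G a (Str M a x) (Str M a y)"
      if "x \<in> Val M a" "y \<in> Val M a" "a \<in> Ob A" for a x y
      using prod that by (simp_all add: over_map_def psh_map_def crs_prod_def Pi_iff)
    have 2: "Res M f (Mul M b x y) = Mul M a (Res M (Act G (Str M b y) f) x) (Res M f y)"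
      if "f \<in> Hom A a b" "x \<in> Val M b" "y \<in> Val M b" for a b x y f
    proof -
      have "Cod A f = b" using AD that by blast
      moreover have "\<forall>a b. \<forall>f\<in>Hom A a b. \<forall>x\<in>Val M b. \<forall>y\<in>Val M b.
          Mul M a (Res M (Act G (Str M (Cod A f) y) f) x) (Res M f y) = Res M f (Mul M b x y)"
        using prod by (simp add: over_map_def psh_map_def crs_prod_def)
      ultimately show ?thesis using that by metis
    qed
    have 3: "Str M a (One M a) = GOne G a" if "a \<in> Ob A" for a
      using unit that by (simp add: over_map_def psh_map_def crs_unit_def)
    have "crossed_group A ?H"
      unfolding crossed_group_def crossed_group_axioms_def
    proof (intro conjI allI impI, simp_all add: p gr 2)
      fix a b assume ab: "a \<in> Ob A" "b \<in> Ob A"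
      interpret group "Mn M b" using gr ab by auto
      show "group_action (Mn M b) (Hom A a b) (\<lambda>x. restrict (Act ?H x) (Hom A a b))"
        apply (rule actI)
        by (simp_all add: is_group gact S 1 3 ab A[of _ a b])
    next
      fix f a b g c x
      assume f: "f \<in> Hom A a b" and g: "g \<in> Hom A b c" and x: "x \<in> Val M c"
      have "Str M b (Res M g x) = Res G g (Str M c x)" using p g x by (auto simp: psh_map_def)
      then show "Act ?H x (Comp A g f) = Comp A (Act G (Str M c x) g) (Act G (Str M b (Res M g x)) f)"
        using G.Act_Comp[OF f g S] x AD[OF g] A[OF A.Comp_Hom[OF f g]] by auto
    qed
    moreover have "crs_grp_map A ?H G (Str M)"
      by (auto simp: crs_grp_map_def p hom_def 1 S)
    ultimately show "crossed_group A ?H \<and> crs_grp_map A ?H G (Str M)" ..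
  next
    assume *: "crossed_group A ?H \<and> crs_grp_map A ?H G (Str M)"
    interpret H: crossed_group A ?H using * by simp
    have gr: "group (Mn M a)" if "a \<in> Ob A" for a using H.Gp_group[OF that] by simp
    have p: "presheaf A M" "psh_map A M G (Str M)" using H.presheaf_axioms * by (auto simp: crs_grp_map_def)
    have h: "Str M a \<in> hom (Mn M a) (Gp G a)" if "a \<in> Ob A" for a
      using * that by (auto simp: crs_grp_map_def)
    have cl: "Mul M a x y \<in> Val M a" if "a \<in> Ob A" "x \<in> Val M a" "y \<in> Val M a" for a x y
      using monoid.m_closed[OF group.is_monoid[OF gr[OF that(1)]]] that by simp
    have cl1: "One M a \<in> Val M a" if "a \<in> Ob A" for a
      using monoid.one_closed[OF group.is_monoid[OF gr[OF that(1)]]] that by simp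
    have h1: "Str M a (One M a) = GOne G a" if "a \<in> Ob A" for a
      using hom_one[OF h gr G.Gp_group] that by simp
    have "Res M f (One M b) = One M a" if f: "f \<in> Hom A a b" for f a b
    proof -
      have ab: "a \<in> Ob A" "b \<in> Ob A" using AD f by auto
      interpret a: group "Mn M a" using gr ab by auto
      interpret b: group "Mn M b" using gr ab by auto
      have o: "One M b \<in> Val M b" using cl1 ab by auto
      have "Act ?H (One M b) f = f"
        using actD(2)[OF H.Act_action, of a b f] ab f by simp
      then have "Res M f (One M b) = Mul M a (Res M f (One M b)) (Res M f (One M b))"
        using H.Res_GMul[OF f, of "One M b" "One M b"] o b.l_one[of "One M b"] by (simp del: A)
      then show ?thesis
        using a.l_cancel_one'[of "Res M f (One M b)" "Res M f (One M b)"]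
          H.Res_Val[OF f, of "One M b"] o by simp
    qed
    then have "over_map A (crs_unit G) M (\<lambda>a _. One M a)"
      using cl1 h1 by (auto simp: over_map_def psh_map_def crs_unit_def)
    moreover have "Mul M a (Res M (Act G (Str M (Cod A f) y) f) x) (Res M f y) = Res M f (Mul M b x y)"
      if f: "f \<in> Hom A a b" and "x \<in> Val M b" "y \<in> Val M b" for a b f x y
      using H.Res_GMul[OF f, of x y] A[OF f] AD[OF f] that by simp
    then have "over_map A (crs_prod A G M M) M (\<lambda>a (x, y). Mul M a x y)"
      using cl h by (auto simp: over_map_def psh_map_def crs_prod_def hom_def)
    ultimately show "M \<in> Ob (CrsGrp A G)"
      using p gr by (auto simp: CrsGrp_def full_subcat_def CrsMon_def mon_obj_def over_obj_def
          group.is_monoid)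
  qed
qed

theorem CrsGrp_Ar_iff:
  assumes "category A" "M \<in> Ob (CrsGrp A G)" "N \<in> Ob (CrsGrp A G)"
    and ext: "h \<in> (\<Pi>\<^sub>E a\<in>Ob A. Val M a \<rightarrow>\<^sub>E Val N a)"
  shows "(M, h, N) \<in> Ar (CrsGrp A G) \<longleftrightarrow>
    crs_grp_map A (crs_grp_of A G M) (crs_grp_of A G N) h \<and>
    (\<forall>a\<in>Ob A. \<forall>x\<in>Val M a. Str N a (h a x) = Str M a x)"
proof -
  have M: "mon_obj A G M" "\<And>a. a \<in> Ob A \<Longrightarrow> group (Mn M a)"
    and N: "mon_obj A G N" "\<And>a. a \<in> Ob A \<Longrightarrow> group (Mn N a)"
    using assms(2,3) by (auto simp: CrsGrp_def CrsMon_def full_subcat_def)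
  have Gp: "Gp (crs_grp_of A G M) = Mn M" "Gp (crs_grp_of A G N) = Mn N"
    by (auto simp: crs_grp_of_def Gp_def Mn_def)
  have one: "h a (One M a) = One N a" if "a \<in> Ob A" "h a \<in> hom (Mn M a) (Mn N a)" for a
    using hom_one[OF that(2) M(2) N(2)] that(1) by simp
  have psh: "psh_map A (crs_grp_of A G M) (crs_grp_of A G N) h = psh_map A M N h"
    by (simp add: psh_map_def crs_grp_of_def)
  have "Act (crs_grp_of A G N) (h b x) f = Act (crs_grp_of A G M) x f"
    if "\<forall>a\<in>Ob A. \<forall>x\<in>Val M a. Str N a (h a x) = Str M a x"
      "f \<in> Hom A a b" "x \<in> Val (crs_grp_of A G M) b" for a b f x
    using that HomD[OF assms(1) that(2)] by (simp add: crs_grp_of_def)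
  note act = this
  have Ar: "(M, h, N) \<in> Ar (CrsGrp A G) \<longleftrightarrow> mon_map A M N h"
    using M N ext by (simp add: CrsGrp_def CrsMon_def full_subcat_def)
  show ?thesis
    unfolding Ar crs_grp_map_def mon_map_def over_map_def psh Gp using one act by blast
qed


section \<open>Base change\<close>

definition stable_under :: "('o, 'm) cat \<Rightarrow> ('o2, 'm2, 'g) crs_grp \<Rightarrow>
    ('o, 'm, 'o2, 'm2) funct \<Rightarrow> bool" where
  "stable_under A G \<phi> \<longleftrightarrow> (\<forall>a\<in>Ob A. \<forall>b\<in>Ob A. \<forall>x\<in>Val G (FOb \<phi> b).
    Act G x ` (FAr \<phi> ` Hom A a b) \<subseteq> FAr \<phi> ` Hom A a b)"

text \<open>For faithful, \<open>G\<close>-stable \<open>\<phi>\<close>, \<open>f\<^sup>x\<close> in the pullback is the unique arrow parallel to \<open>f\<close> with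
  \<open>\<phi> (f\<^sup>x) = (\<phi> f)\<^sup>x\<close>.\<close>

definition pull_grp :: "('o, 'm) cat \<Rightarrow> ('o, 'm, 'o2, 'm2) funct \<Rightarrow> ('o2, 'm2, 'g) crs_grp \<Rightarrow>
    ('o, 'm, 'g) crs_grp" where
  "pull_grp A \<phi> G =
    \<lparr> Val = (\<lambda>a. Val G (FOb \<phi> a)), Res = (\<lambda>f. Res G (FAr \<phi> f)),
      GMul = (\<lambda>a. GMul G (FOb \<phi> a)), GOne = (\<lambda>a. GOne G (FOb \<phi> a)),
      Act = (\<lambda>x f. the_inv_into (Hom A (Dom A f) (Cod A f)) (FAr \<phi>) (Act G x (FAr \<phi> f))) \<rparr>"

definition pull_mon :: "('o, 'm, 'o2, 'm2) funct \<Rightarrow> ('o2, 'm2, 'u, 'g) crs_mon \<Rightarrow>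
    ('o, 'm, 'u, 'g) crs_mon" where
  "pull_mon \<phi> M =
    \<lparr> Val = (\<lambda>a. Val M (FOb \<phi> a)), Res = (\<lambda>f. Res M (FAr \<phi> f)), Str = (\<lambda>a. Str M (FOb \<phi> a)),
      Mul = (\<lambda>a. Mul M (FOb \<phi> a)), One = (\<lambda>a. One M (FOb \<phi> a)) \<rparr>"

text \<open>The functor \<open>\<phi>\<^sup>\<natural>\<close> on crossed monoids.\<close>

definition pull_functor :: "('o, 'm) cat \<Rightarrow> ('o, 'm, 'o2, 'm2) funct \<Rightarrow>
    (('o2, 'm2, 'u, 'g) crs_mon, ('o2, 'm2, 'u, 'g) crs_mon_arr,
     ('o, 'm, 'u, 'g) crs_mon, ('o, 'm, 'u, 'g) crs_mon_arr) funct" where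
  "pull_functor A \<phi> =
    \<lparr> FOb = pull_mon \<phi>,
      FAr = (\<lambda>(M, h, N). (pull_mon \<phi> M, \<lambda>a\<in>Ob A. h (FOb \<phi> a), pull_mon \<phi> N)) \<rparr>"

end

theory Submission
  imports Defs
begin

text \<open>The unit of \<open>\<phi>\<^sub>\<flat> \<stileturn> \<phi>\<^sup>\<natural>\<close> at a crossed group \<open>M\<close> takes values in the units of \<open>\<phi>\<^sub>\<flat>M\<close>. These form a
  crossed submonoid, which is everything by universality. For \<open>N = \<phi>\<^sub>\<sharp>M\<close> with counit
  \<open>\<epsilon> : \<phi>\<^sup>\<natural>N \<rightarrow> M\<close>, the kernel pair of the family \<open>x \<mapsto> (\<epsilon>(f\<^sup>*x))\<close>, \<open>f : \<phi>(a) \<rightarrow> b\<close>, is a crossed monoid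
  whose two projections to \<open>N\<close> have the same transpose, so these families separate elements of \<open>N\<close>
  with the same image in \<open>G\<close>. If \<open>M\<close> is a crossed group, \<open>x \<mapsto> \<epsilon>(x)\<^sup>-\<^sup>1\<close> is a map to \<open>M\<close> from the
  restriction of the opposite of \<open>N\<close>; separation shows that its transpose produces inverses in \<open>N\<close>.
  If \<open>\<phi>\<close> is fully faithful, \<open>\<epsilon>\<close> is injective by separation, and surjective because of the maps
  to \<open>N\<close> from free crossed monoids on representables. So \<open>\<epsilon>\<close> is invertible, which makes both adjoints
  fully faithful.\<close>

section \<open>Adjunctions\<close>

definition is_iso :: "('o, 'm) cat \<Rightarrow> 'm \<Rightarrow> 'o \<Rightarrow> 'o \<Rightarrow> bool" where
  "is_iso C f a b \<longleftrightarrow> f \<in> Hom C a b \<and>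
    (\<exists>g\<in>Hom C b a. Comp C g f = Ide C a \<and> Comp C f g = Ide C b)"

section \<open>Transposition in an adjunction, and full faithfulness from an invertible unit or
  counit\<close>

locale cat_adjunction = C: category C + D: category D + adjunction C D L R \<eta> \<epsilon>
  for C :: "('o1, 'm1) cat" and D :: "('o2, 'm2) cat"
    and L :: "('o1, 'm1, 'o2, 'm2) funct" and R :: "('o2, 'm2, 'o1, 'm1) funct"
    and \<eta> :: "'o1 \<Rightarrow> 'm1" and \<epsilon> :: "'o2 \<Rightarrow> 'm2"
begin

sublocale L: is_functor C D L by (fact L_functor)
sublocale R: is_functor D C R by (fact R_functor)

text \<open>Naturality of \<epsilon> carries \<open>g\<close> past the counit, and the triangle
  identity at \<open>a\<close> cancels what remains. With \<open>right_transpose\<close> it makes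
  the two transpositions mutually inverse.\<close>

lemma left_transpose:
  assumes a: "a \<in> Ob C" and x: "x \<in> Ob D" and g: "g \<in> Hom D (FOb L a) x"
  shows "Comp D (\<epsilon> x) (FAr L (Comp C (FAr R g) (\<eta> a))) = g"
proof -
  have La: "FOb L a \<in> Ob D" using L.FOb_Ob a .
  have Lh: "FAr L (\<eta> a) \<in> Hom D (FOb L a) (FOb L (FOb R (FOb L a)))"
    using L.FAr_Hom unit_Hom a by blast
  have LRg: "FAr L (FAr R g) \<in> Hom D (FOb L (FOb R (FOb L a))) (FOb L (FOb R x))"
    using L.FAr_Hom R.FAr_Hom g by blast
  have "Comp D (\<epsilon> x) (FAr L (Comp C (FAr R g) (\<eta> a)))
      = Comp D (\<epsilon> x) (Comp D (FAr L (FAr R g)) (FAr L (\<eta> a)))"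
    using L.FAr_Comp[OF unit_Hom[OF a] R.FAr_Hom[OF g]] by simp
  also have "\<dots> = Comp D (Comp D g (\<epsilon> (FOb L a))) (FAr L (\<eta> a))"
    using D.Comp_assoc[OF Lh LRg counit_Hom[OF x]] counit_natural[OF g] by simp
  also have "\<dots> = g"
    using D.Comp_assoc[OF Lh counit_Hom[OF La] g] triangle_L[OF a] D.Comp_Ide[OF g] by simp
  finally show ?thesis .
qed

lemma right_transpose:
  assumes a: "a \<in> Ob C" and x: "x \<in> Ob D" and f: "f \<in> Hom C a (FOb R x)"
  shows "Comp C (FAr R (Comp D (\<epsilon> x) (FAr L f))) (\<eta> a) = f"
proof -
  have Rx: "FOb R x \<in> Ob C" using R.FOb_Ob x .
  have Re: "FAr R (\<epsilon> x) \<in> Hom C (FOb R (FOb L (FOb R x))) (FOb R x)"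
    using R.FAr_Hom counit_Hom x by blast
  have RLf: "FAr R (FAr L f) \<in> Hom C (FOb R (FOb L a)) (FOb R (FOb L (FOb R x)))"
    using L.FAr_Hom R.FAr_Hom f by blast
  have "Comp C (FAr R (Comp D (\<epsilon> x) (FAr L f))) (\<eta> a)
      = Comp C (Comp C (FAr R (\<epsilon> x)) (FAr R (FAr L f))) (\<eta> a)"
    using R.FAr_Comp[OF L.FAr_Hom[OF f] counit_Hom[OF x]] by simp
  also have "\<dots> = Comp C (FAr R (\<epsilon> x)) (Comp C (\<eta> (FOb R x)) f)"
    using C.Comp_assoc[OF unit_Hom[OF a] RLf Re] unit_natural[OF f] by simp
  also have "\<dots> = f"
    using C.Comp_assoc[OF f unit_Hom[OF Rx] Re] triangle_R[OF x] C.Ide_Comp[OF f] by simp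
  finally show ?thesis .
qed

lemma left_transpose_Hom:
  assumes "x \<in> Ob D" and "f \<in> Hom C a (FOb R x)"
  shows "Comp D (\<epsilon> x) (FAr L f) \<in> Hom D (FOb L a) x"
  using D.Comp_Hom[OF L.FAr_Hom[OF assms(2)] counit_Hom[OF assms(1)]] .

lemma right_transpose_Hom:
  assumes "a \<in> Ob C" and "g \<in> Hom D (FOb L a) x"
  shows "Comp C (FAr R g) (\<eta> a) \<in> Hom C a (FOb R x)"
  using C.Comp_Hom[OF unit_Hom[OF assms(1)] R.FAr_Hom[OF assms(2)]] .

text \<open>Transposing back recovers both arrows from their composites with the unit. Cancellation
  is asserted only against arrows in the image of \<open>R\<close>, not against all arrows of
  \<open>C\<close>.\<close>

lemma unit_epi:
  assumes "a \<in> Ob C" "x \<in> Ob D" "g \<in> Hom D (FOb L a) x" "g' \<in> Hom D (FOb L a) x"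
    and "Comp C (FAr R g) (\<eta> a) = Comp C (FAr R g') (\<eta> a)"
  shows "g = g'"
  using left_transpose[OF assms(1,2)] assms(3-5) by metis

lemma counit_mono:
  assumes "a \<in> Ob C" "x \<in> Ob D" "f \<in> Hom C a (FOb R x)" "f' \<in> Hom C a (FOb R x)"
    and "Comp D (\<epsilon> x) (FAr L f) = Comp D (\<epsilon> x) (FAr L f')"
  shows "f = f'"
  using right_transpose[OF assms(1,2)] assms(3-5) by metis

text \<open>Under the transposition Hom(L a, L b) = Hom(a, R L b), the map \<open>L\<close> becomes
  composition with \<open>\<eta> b\<close>. Its inverse is therefore to transpose and then apply the
  inverse \<open>k\<close> of \<open>\<eta> b\<close>.\<close>

lemma fully_faithful_left:
  assumes iso: "\<And>a. a \<in> Ob C \<Longrightarrow> is_iso C (\<eta> a) a (FOb R (FOb L a))"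
  shows "fully_faithful C D L"
  unfolding fully_faithful_def
proof (intro ballI)
  fix a b assume a: "a \<in> Ob C" and b: "b \<in> Ob C"
  obtain k where k: "k \<in> Hom C (FOb R (FOb L b)) b" and k1: "Comp C k (\<eta> b) = Ide C b"
    and k2: "Comp C (\<eta> b) k = Ide C (FOb R (FOb L b))"
    using iso[OF b] by (auto simp: is_iso_def)
  have Lb: "FOb L b \<in> Ob D" using L.FOb_Ob b .
  show "bij_betw (FAr L) (Hom C a b) (Hom D (FOb L a) (FOb L b))"
  proof (rule bij_betw_byWitness[where f' = "\<lambda>g. Comp C k (Comp C (FAr R g) (\<eta> a))"])
    show "\<forall>f\<in>Hom C a b. Comp C k (Comp C (FAr R (FAr L f)) (\<eta> a)) = f"
      using unit_natural C.Comp_assoc[OF _ unit_Hom[OF b] k] k1 C.Ide_Comp by metis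
    show "FAr L ` Hom C a b \<subseteq> Hom D (FOb L a) (FOb L b)"
      using L.FAr_Hom by blast
    show *: "(\<lambda>g. Comp C k (Comp C (FAr R g) (\<eta> a))) ` Hom D (FOb L a) (FOb L b) \<subseteq> Hom C a b"
      using C.Comp_Hom[OF right_transpose_Hom[OF a] k] by blast
    show "\<forall>g\<in>Hom D (FOb L a) (FOb L b). FAr L (Comp C k (Comp C (FAr R g) (\<eta> a))) = g"
    proof
      fix g assume g: "g \<in> Hom D (FOb L a) (FOb L b)"
      let ?f = "Comp C k (Comp C (FAr R g) (\<eta> a))"
      have f: "?f \<in> Hom C a b" using * g by blast
      have "Comp C (FAr R (FAr L ?f)) (\<eta> a) = Comp C (\<eta> b) ?f"
        using unit_natural[OF f] by simp
      also have "\<dots> = Comp C (FAr R g) (\<eta> a)"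
        using C.Comp_assoc[OF right_transpose_Hom[OF a g] k unit_Hom[OF b]] k2
          C.Ide_Comp[OF right_transpose_Hom[OF a g]] by simp
      finally show "FAr L ?f = g"
        using unit_epi[OF a Lb L.FAr_Hom[OF f] g] by blast
    qed
  qed
qed

lemma fully_faithful_right:
  assumes iso: "\<And>x. x \<in> Ob D \<Longrightarrow> is_iso D (\<epsilon> x) (FOb L (FOb R x)) x"
  shows "fully_faithful D C R"
  unfolding fully_faithful_def
proof (intro ballI)
  fix x y assume x: "x \<in> Ob D" and y: "y \<in> Ob D"
  obtain k where k: "k \<in> Hom D x (FOb L (FOb R x))"
    and k1: "Comp D k (\<epsilon> x) = Ide D (FOb L (FOb R x))" and k2: "Comp D (\<epsilon> x) k = Ide D x"
    using iso[OF x] by (auto simp: is_iso_def)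
  have Rx: "FOb R x \<in> Ob C" using R.FOb_Ob x .
  show "bij_betw (FAr R) (Hom D x y) (Hom C (FOb R x) (FOb R y))"
  proof (rule bij_betw_byWitness[where f' = "\<lambda>f. Comp D (Comp D (\<epsilon> y) (FAr L f)) k"])
    show "\<forall>g\<in>Hom D x y. Comp D (Comp D (\<epsilon> y) (FAr L (FAr R g))) k = g"
      using counit_natural D.Comp_assoc[OF k counit_Hom[OF x]] k2 D.Comp_Ide by metis
    show "FAr R ` Hom D x y \<subseteq> Hom C (FOb R x) (FOb R y)"
      using R.FAr_Hom by blast
    show *: "(\<lambda>f. Comp D (Comp D (\<epsilon> y) (FAr L f)) k) ` Hom C (FOb R x) (FOb R y) \<subseteq> Hom D x y"
      using D.Comp_Hom[OF k left_transpose_Hom[OF y]] by blast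
    show "\<forall>f\<in>Hom C (FOb R x) (FOb R y). FAr R (Comp D (Comp D (\<epsilon> y) (FAr L f)) k) = f"
    proof
      fix f assume f: "f \<in> Hom C (FOb R x) (FOb R y)"
      let ?g = "Comp D (Comp D (\<epsilon> y) (FAr L f)) k"
      have g: "?g \<in> Hom D x y" using * f by blast
      have "Comp D (\<epsilon> y) (FAr L (FAr R ?g)) = Comp D ?g (\<epsilon> x)"
        using counit_natural[OF g] by simp
      also have "\<dots> = Comp D (\<epsilon> y) (FAr L f)"
        using D.Comp_assoc[OF counit_Hom[OF x] k left_transpose_Hom[OF y f]] k1
          D.Comp_Ide[OF left_transpose_Hom[OF y f]] by simp
      finally show "FAr R ?g = f"
        using counit_mono[OF Rx y R.FAr_Hom[OF g] f] by blast
    qed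
  qed
qed

end

text \<open>Invertibility travels along the adjoint triple L, R, S. The inverse of
  \<open>\<epsilon>' a\<close> yields a retraction \<open>r\<close> of \<open>\<eta> a\<close>, and
  invertible counits make \<open>\<eta> a\<close> epic; an epic arrow with a retraction is
  invertible.\<close>

lemma unit_iso_of_counit_iso:
  assumes "cat_adjunction C D L R \<eta> \<epsilon>" and "cat_adjunction D C R S \<eta>' \<epsilon>'"
    and iso: "\<And>a. a \<in> Ob C \<Longrightarrow> is_iso C (\<epsilon>' a) (FOb R (FOb S a)) a"
    and a: "a \<in> Ob C"
  shows "is_iso C (\<eta> a) a (FOb R (FOb L a))"
proof -
  interpret l: cat_adjunction C D L R \<eta> \<epsilon> by fact
  interpret r: cat_adjunction D C R S \<eta>' \<epsilon>' by fact
  note obs = l.L.FOb_Ob l.R.FOb_Ob r.R.FOb_Ob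
  let ?T = "FOb R (FOb L a)"
  have La: "FOb L a \<in> Ob D" and T: "?T \<in> Ob C" and Sa: "FOb S a \<in> Ob D" using obs a by blast+
  note \<eta> = l.unit_Hom[OF a]
  obtain c where c: "c \<in> Hom C a (FOb R (FOb S a))" and c2: "Comp C (\<epsilon>' a) c = Ide C a"
    using iso[OF a] by (auto simp: is_iso_def)
  \<comment> \<open>The transpose of \<open>c\<close> for \<open>L\<close> and \<open>R\<close>:
    \<open>R j\<close> extends \<open>c\<close> along the unit, and composing with
    \<open>\<epsilon>' a\<close> undoes \<open>c\<close>.\<close>
  define j where "j = Comp D (\<epsilon> (FOb S a)) (FAr L c)"
  have j: "j \<in> Hom D (FOb L a) (FOb S a)" unfolding j_def using l.left_transpose_Hom[OF Sa c] .
  have jc: "Comp C (FAr R j) (\<eta> a) = c" unfolding j_def using l.right_transpose[OF a Sa c] .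
  define r where "r = Comp C (\<epsilon>' a) (FAr R j)"
  have r: "r \<in> Hom C ?T a" unfolding r_def using r.left_transpose_Hom[OF a j] .
  have r1: "Comp C r (\<eta> a) = Ide C a"
    using l.C.Comp_assoc[OF \<eta> l.R.FAr_Hom[OF j] r.counit_Hom[OF a]] jc c2 by (simp add: r_def)
  have epi: "u = v" if u: "u \<in> Hom C ?T b" and v: "v \<in> Hom C ?T b" and b: "b \<in> Ob C"
    and uv: "Comp C u (\<eta> a) = Comp C v (\<eta> a)" for u v b
  proof -
    have Sb: "FOb S b \<in> Ob D" using obs b by blast
    obtain k where k: "k \<in> Hom C b (FOb R (FOb S b))"
      and k1: "Comp C k (\<epsilon>' b) = Ide C (FOb R (FOb S b))"
      using iso[OF b] by (auto simp: is_iso_def)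
    \<comment> \<open>The transpose of \<open>w\<close> for \<open>R\<close> and \<open>S\<close>.
      As \<open>\<epsilon>' b\<close> has the inverse \<open>k\<close>, the arrow
      \<open>R (t w)\<close> is \<open>k\<close> after \<open>w\<close>, which brings
      \<open>w\<close> within reach of \<open>unit_epi\<close>.\<close>
    define t where "t = (\<lambda>w. Comp D (FAr S w) (\<eta>' (FOb L a)))"
    have t: "t w \<in> Hom D (FOb L a) (FOb S b)" if "w \<in> Hom C ?T b" for w
      unfolding t_def using r.right_transpose_Hom[OF La that] .
    have t2: "Comp C (\<epsilon>' b) (FAr R (t w)) = w" if "w \<in> Hom C ?T b" for w
      unfolding t_def using r.left_transpose[OF La b that] .
    have "Comp C (FAr R (t w)) (\<eta> a) = Comp C k (Comp C w (\<eta> a))" if w: "w \<in> Hom C ?T b" for w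
    proof -
      have Rt: "FAr R (t w) \<in> Hom C ?T (FOb R (FOb S b))" using l.R.FAr_Hom t w by blast
      have "Comp C k w = FAr R (t w)"
        using l.C.Comp_assoc[OF Rt r.counit_Hom[OF b] k] k1 t2[OF w] l.C.Ide_Comp[OF Rt] by simp
      then show ?thesis using l.C.Comp_assoc[OF \<eta> w k] by simp
    qed
    then have "t u = t v" using l.unit_epi[OF a Sb t[OF u] t[OF v]] u v uv by simp
    then show ?thesis using t2 u v by metis
  qed
  have "Comp C (\<eta> a) r = Ide C ?T"
  proof (rule epi[OF l.C.Comp_Hom[OF r \<eta>] l.C.Ide_Hom[OF T] T])
    show "Comp C (Comp C (\<eta> a) r) (\<eta> a) = Comp C (Ide C ?T) (\<eta> a)"
      using l.C.Comp_assoc[OF \<eta> r \<eta>] r1 l.C.Comp_Ide[OF \<eta>] l.C.Ide_Comp[OF \<eta>] by simp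
  qed
  then show ?thesis using \<eta> r r1 by (auto simp: is_iso_def)
qed

section \<open>Restriction to full subcategories\<close>

lemma full_subcat_sel [simp]:
  "Ob (full_subcat C S) = Ob C \<inter> S"
  "Ide (full_subcat C S) = Ide C" "Comp (full_subcat C S) = Comp C"
  by (simp_all add: full_subcat_def)

lemma Hom_full_subcat: "Hom (full_subcat C S) a b = (if a \<in> S \<and> b \<in> S then Hom C a b else {})"
  by (auto simp: full_subcat_def Hom_def)

lemma is_functor_full_subcat:
  assumes "is_functor C D F" and "\<And>a. a \<in> Ob C \<Longrightarrow> a \<in> S \<Longrightarrow> FOb F a \<in> T" and "category C"
  shows "is_functor (full_subcat C S) (full_subcat D T) F"
proof -
  interpret is_functor C D F by fact
  show ?thesis
  proof
    fix f a b assume "f \<in> Hom (full_subcat C S) a b"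
    then have "f \<in> Hom C a b" "a \<in> S" "b \<in> S" by (auto simp: Hom_full_subcat split: if_splits)
    then show "FAr F f \<in> Hom (full_subcat D T) (FOb F a) (FOb F b)"
      using FAr_Hom assms(2) HomD[OF assms(3)] by (simp add: Hom_full_subcat)
  qed (auto simp: Hom_full_subcat FOb_Ob FAr_Ide FAr_Comp assms(2) split: if_splits)
qed

text \<open>Fullness puts the unit and counit components into the subcategories once objects are
  preserved; all equations are inherited. The restriction claim thus reduces to showing that the
  three functors preserve degreewise groups.\<close>

lemma adjunction_full_subcat:
  assumes "adjunction C D L R \<eta> \<epsilon>" and "category C" and "category D"
    and L: "\<And>a. a \<in> Ob C \<Longrightarrow> a \<in> S \<Longrightarrow> FOb L a \<in> T"
    and R: "\<And>x. x \<in> Ob D \<Longrightarrow> x \<in> T \<Longrightarrow> FOb R x \<in> S"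
  shows "adjunction (full_subcat C S) (full_subcat D T) L R \<eta> \<epsilon>"
proof -
  interpret adjunction C D L R \<eta> \<epsilon> by fact
  have "FOb L a \<in> Ob D" if "a \<in> Ob C" for a using L_functor that by (simp add: is_functor_def)
  moreover have "FOb R x \<in> Ob C" if "x \<in> Ob D" for x using R_functor that by (simp add: is_functor_def)
  ultimately show ?thesis
    using is_functor_full_subcat[OF L_functor L assms(2)] is_functor_full_subcat[OF R_functor R assms(3)]
    by (intro adjunction.intro)
      (auto simp: Hom_full_subcat unit_Hom counit_Hom unit_natural counit_natural triangle_L
        triangle_R L R split: if_splits)
qed

lemma fully_faithful_full_subcat:
  assumes "fully_faithful C D F" and "\<And>a. a \<in> Ob C \<Longrightarrow> a \<in> S \<Longrightarrow> FOb F a \<in> T"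
  shows "fully_faithful (full_subcat C S) (full_subcat D T) F"
  using assms by (simp add: fully_faithful_def Hom_full_subcat)

section \<open>Crossed monoids\<close>

locale crossed_site = category A + crossed_group A G
  for A :: "('o, 'm) cat" and G :: "('o, 'm, 'g) crs_grp"
begin

lemmas Hom_Ob = HomD[OF category_axioms]

lemma Cod_Hom: "f \<in> Hom A a b \<Longrightarrow> Cod A f = b"
  by (simp add: Hom_def)

abbreviation ginv :: "'o \<Rightarrow> 'g \<Rightarrow> 'g" where
  "ginv b x \<equiv> inv\<^bsub>Gp G b\<^esub> x"

lemma
  assumes "f \<in> Hom A a b"
  shows Act_Hom: "x \<in> Val G b \<Longrightarrow> Act G x f \<in> Hom A a b"
    and Act_GOne: "Act G (GOne G b) f = f"
    and Act_GMul: "x \<in> Val G b \<Longrightarrow> y \<in> Val G b \<Longrightarrow> Act G (GMul G b x y) f = Act G x (Act G y f)"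
  using actD[OF Act_action, of a b] assms Hom_Ob[OF assms] by auto

lemma
  assumes "b \<in> Ob A"
  shows GMul_Val: "x \<in> Val G b \<Longrightarrow> y \<in> Val G b \<Longrightarrow> GMul G b x y \<in> Val G b"
    and GOne_Val: "GOne G b \<in> Val G b"
    and GMul_assoc: "x \<in> Val G b \<Longrightarrow> y \<in> Val G b \<Longrightarrow> z \<in> Val G b \<Longrightarrow>
      GMul G b (GMul G b x y) z = GMul G b x (GMul G b y z)"
    and GMul_GOne: "x \<in> Val G b \<Longrightarrow> GMul G b x (GOne G b) = x"
    and GOne_GMul: "x \<in> Val G b \<Longrightarrow> GMul G b (GOne G b) x = x"
    and ginv_Val: "x \<in> Val G b \<Longrightarrow> ginv b x \<in> Val G b"
    and GMul_ginv: "x \<in> Val G b \<Longrightarrow> GMul G b x (ginv b x) = GOne G b"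
    and ginv_GMul: "x \<in> Val G b \<Longrightarrow> GMul G b (ginv b x) x = GOne G b"
    and ginv_GOne: "ginv b (GOne G b) = GOne G b"
    and ginv_mult: "x \<in> Val G b \<Longrightarrow> y \<in> Val G b \<Longrightarrow>
      ginv b (GMul G b x y) = GMul G b (ginv b y) (ginv b x)"
proof -
  interpret group "Gp G b" using Gp_group assms .
  show "x \<in> Val G b \<Longrightarrow> y \<in> Val G b \<Longrightarrow> GMul G b x y \<in> Val G b"
    "GOne G b \<in> Val G b"
    "x \<in> Val G b \<Longrightarrow> y \<in> Val G b \<Longrightarrow> z \<in> Val G b \<Longrightarrow>
      GMul G b (GMul G b x y) z = GMul G b x (GMul G b y z)"
    "x \<in> Val G b \<Longrightarrow> GMul G b x (GOne G b) = x"
    "x \<in> Val G b \<Longrightarrow> GMul G b (GOne G b) x = x"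
    "x \<in> Val G b \<Longrightarrow> ginv b x \<in> Val G b"
    "x \<in> Val G b \<Longrightarrow> GMul G b x (ginv b x) = GOne G b"
    "x \<in> Val G b \<Longrightarrow> GMul G b (ginv b x) x = GOne G b"
    "ginv b (GOne G b) = GOne G b"
    "x \<in> Val G b \<Longrightarrow> y \<in> Val G b \<Longrightarrow> ginv b (GMul G b x y) = GMul G b (ginv b y) (ginv b x)"
    using m_closed[of x y] one_closed m_assoc[of x y z] r_one[of x] l_one[of x] inv_closed[of x]
      r_inv[of x] l_inv[of x] inv_one inv_mult_group[of x y] by simp_all
qed

lemma
  assumes "f \<in> Hom A a b" and "x \<in> Val G b"
  shows Act_ginv_Act: "Act G (ginv b x) (Act G x f) = f"
    and Act_Act_ginv: "Act G x (Act G (ginv b x) f) = f"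
proof -
  have b: "b \<in> Ob A" using Hom_Ob assms by blast
  note x = assms(2) ginv_Val[OF b assms(2)]
  show "Act G (ginv b x) (Act G x f) = f"
    using Act_GMul[OF assms(1) x(2,1)] ginv_GMul[OF b x(1)] Act_GOne[OF assms(1)] by simp
  show "Act G x (Act G (ginv b x) f) = f"
    using Act_GMul[OF assms(1) x] GMul_ginv[OF b x(1)] Act_GOne[OF assms(1)] by simp
qed

text \<open>Let f be the identity twisted by x^-1, and apply \<open>Act_Comp\<close> to id after f.
  Restriction along id fixes x and f^x = id, so id equals id^x after id.\<close>

lemma Act_Ide:
  assumes a: "a \<in> Ob A" and x: "x \<in> Val G a"
  shows "Act G x (Ide A a) = Ide A a"
proof -
  let ?i = "Ide A a"
  note i = Ide_Hom[OF a]
  define f where "f = Act G (ginv a x) ?i"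
  have f: "f \<in> Hom A a a" unfolding f_def using Act_Hom[OF i] ginv_Val[OF a x] .
  have fx: "Act G x f = ?i" unfolding f_def using Act_Act_ginv[OF i x] .
  have "Act G x f = Comp A (Act G x ?i) (Act G x f)"
    using Act_Comp[OF f i x] Ide_Comp[OF f] Res_Ide[OF a x] by simp
  then show ?thesis using fx Comp_Ide[OF Act_Hom[OF i x]] by simp
qed

text \<open>The unit acts trivially, so \<open>Res_GMul\<close> makes its restriction idempotent,
  and a group has only one idempotent.\<close>

lemma Res_GOne:
  assumes f: "f \<in> Hom A a b"
  shows "Res G f (GOne G b) = GOne G a"
proof -
  have ab: "a \<in> Ob A" "b \<in> Ob A" using Hom_Ob f by blast+
  interpret group "Gp G a" using Gp_group ab by blast
  note one = GOne_Val[OF ab(2)]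
  have "GMul G a (Res G f (GOne G b)) (Res G f (GOne G b)) = Res G f (GOne G b)"
    using Res_GMul[OF f one one] GMul_GOne[OF ab(2) one] Act_GOne[OF f] by simp
  then show ?thesis
    using l_cancel_one[of "Res G f (GOne G b)" "Res G f (GOne G b)"] Res_Val[OF f one] by simp
qed

text \<open>Restrict x x^-1 = 1 along f: the factor x is restricted along f twisted by x^-1. This is
  where the twist in \<open>opp_mon\<close> comes from.\<close>

lemma Res_ginv:
  assumes f: "f \<in> Hom A a b" and x: "x \<in> Val G b"
  shows "Res G f (ginv b x) = ginv a (Res G (Act G (ginv b x) f) x)"
proof -
  have ab: "a \<in> Ob A" "b \<in> Ob A" using Hom_Ob f by blast+
  interpret group "Gp G a" using Gp_group ab by blast
  note x' = ginv_Val[OF ab(2) x]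
  have "GMul G a (Res G (Act G (ginv b x) f) x) (Res G f (ginv b x)) = GOne G a"
    using Res_GMul[OF f x x'] GMul_ginv[OF ab(2) x] Res_GOne[OF f] by simp
  then show ?thesis
    using Res_Val[OF Act_Hom[OF f x'] x] Res_Val[OF f x'] Gp_sel
    by (metis inv_equality inv_inv)
qed

end

text \<open>The maps out of \<open>crs_prod\<close> and \<open>crs_unit\<close> in
  \<open>mon_obj\<close>, unfolded to elements; \<open>mon_obj_iff\<close> proves the
  equivalence.\<close>

locale crossed_monoid = crossed_site A G + M: presheaf A M
  for A :: "('o, 'm) cat" and G :: "('o, 'm, 'g) crs_grp" and M :: "('o, 'm, 'u, 'g) crs_mon" +
  assumes Str_Val: "a \<in> Ob A \<Longrightarrow> x \<in> Val M a \<Longrightarrow> Str M a x \<in> Val G a"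
    and Str_Res: "f \<in> Hom A a b \<Longrightarrow> x \<in> Val M b \<Longrightarrow> Str M a (Res M f x) = Res G f (Str M b x)"
    and Mul_Val: "a \<in> Ob A \<Longrightarrow> x \<in> Val M a \<Longrightarrow> y \<in> Val M a \<Longrightarrow> Mul M a x y \<in> Val M a"
    and One_Val: "a \<in> Ob A \<Longrightarrow> One M a \<in> Val M a"
    and Mul_assoc: "a \<in> Ob A \<Longrightarrow> x \<in> Val M a \<Longrightarrow> y \<in> Val M a \<Longrightarrow> z \<in> Val M a \<Longrightarrow>
      Mul M a (Mul M a x y) z = Mul M a x (Mul M a y z)"
    and Mul_One: "a \<in> Ob A \<Longrightarrow> x \<in> Val M a \<Longrightarrow> Mul M a x (One M a) = x"
    and One_Mul: "a \<in> Ob A \<Longrightarrow> x \<in> Val M a \<Longrightarrow> Mul M a (One M a) x = x"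
    and Str_Mul: "a \<in> Ob A \<Longrightarrow> x \<in> Val M a \<Longrightarrow> y \<in> Val M a \<Longrightarrow>
      Str M a (Mul M a x y) = GMul G a (Str M a x) (Str M a y)"
    and Str_One: "a \<in> Ob A \<Longrightarrow> Str M a (One M a) = GOne G a"
    and Res_Mul: "f \<in> Hom A a b \<Longrightarrow> x \<in> Val M b \<Longrightarrow> y \<in> Val M b \<Longrightarrow>
      Res M f (Mul M b x y) = Mul M a (Res M (Act G (Str M b y) f) x) (Res M f y)"
    and Res_One: "f \<in> Hom A a b \<Longrightarrow> Res M f (One M b) = One M a"
begin

lemma monoid_Mn: "a \<in> Ob A \<Longrightarrow> monoid (Mn M a)"
  by (rule monoidI) (auto simp: Mul_Val One_Val Mul_assoc Mul_One One_Mul)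

end

context crossed_site
begin

lemma mon_obj_iff: "mon_obj A G M \<longleftrightarrow> crossed_monoid A G M"
proof
  assume M: "mon_obj A G M"
  then have p: "presheaf A M" "psh_map A M G (Str M)" by (auto simp: mon_obj_def over_obj_def)
  have prod: "over_map A (crs_prod A G M M) M (\<lambda>a (x, y). Mul M a x y)"
    and unit: "over_map A (crs_unit G) M (\<lambda>a _. One M a)"
    and mon: "monoid (Mn M a)" if "a \<in> Ob A" for a
    using M that by (auto simp: mon_obj_def)
  interpret M: presheaf A M by fact
  show "crossed_monoid A G M"
  proof
    fix f a b x y assume f: "f \<in> Hom A a b" and x: "x \<in> Val M b" and y: "y \<in> Val M b"
    have b: "b \<in> Ob A" using Hom_Ob f by blast
    have "\<forall>a b. \<forall>f\<in>Hom A a b. \<forall>x\<in>Val M b. \<forall>y\<in>Val M b.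
        Mul M a (Res M (Act G (Str M (Cod A f) y) f) x) (Res M f y) = Res M f (Mul M b x y)"
      using prod[OF b] by (simp add: over_map_def psh_map_def crs_prod_def)
    then show "Res M f (Mul M b x y) = Mul M a (Res M (Act G (Str M b y) f) x) (Res M f y)"
      using f x y Cod_Hom by metis
  next
    fix f a b assume f: "f \<in> Hom A a b"
    have b: "b \<in> Ob A" using Hom_Ob f by blast
    show "Res M f (One M b) = One M a"
      using unit[OF b] f by (auto simp: over_map_def psh_map_def crs_unit_def)
  next
    fix a x y assume a: "a \<in> Ob A" and x: "x \<in> Val M a" and y: "y \<in> Val M a"
    show "Str M a (Mul M a x y) = GMul G a (Str M a x) (Str M a y)"
      using prod[OF a] a x y by (simp add: over_map_def psh_map_def crs_prod_def)
  next
    fix a assume a: "a \<in> Ob A"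
    show "Str M a (One M a) = GOne G a"
      using unit[OF a] a by (simp add: over_map_def psh_map_def crs_unit_def)
  qed (use p monoid.m_closed[OF mon] monoid.m_assoc[OF mon] monoid.one_closed[OF mon]
      monoid.r_one[OF mon] monoid.l_one[OF mon] in \<open>auto simp: psh_map_def\<close>)
next
  assume "crossed_monoid A G M"
  then interpret M: crossed_monoid A G M .
  show "mon_obj A G M"
    using Hom_Ob Cod_Hom
    by (auto simp: mon_obj_def over_obj_def over_map_def psh_map_def crs_prod_def crs_unit_def
        M.M.presheaf_axioms M.Str_Val M.Str_Res M.Mul_Val M.One_Val M.monoid_Mn M.Str_Mul M.Str_One
        M.Res_Mul M.Res_One)
qed

end

text \<open>Unlike in \<open>mon_map\<close>, the carriers of source and target may have different
  types. This admits maps from monoids of pairs and of lists to monoids with carriers in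
  \<open>'u\<close>.\<close>

definition crs_hom :: "('o, 'm) cat \<Rightarrow> ('o, 'm, 'u, 'g) crs_mon \<Rightarrow> ('o, 'm, 'v, 'g) crs_mon \<Rightarrow>
    ('o \<Rightarrow> 'u \<Rightarrow> 'v) \<Rightarrow> bool" where
  "crs_hom A M N h \<longleftrightarrow>
    (\<forall>a\<in>Ob A. \<forall>x\<in>Val M a. h a x \<in> Val N a) \<and>
    (\<forall>a\<in>Ob A. \<forall>x\<in>Val M a. Str N a (h a x) = Str M a x) \<and>
    (\<forall>a\<in>Ob A. \<forall>x\<in>Val M a. \<forall>y\<in>Val M a. h a (Mul M a x y) = Mul N a (h a x) (h a y)) \<and>
    (\<forall>a\<in>Ob A. h a (One M a) = One N a) \<and>
    (\<forall>a b. \<forall>f\<in>Hom A a b. \<forall>x\<in>Val M b. h a (Res M f x) = Res N f (h b x))"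

lemma crs_homD:
  assumes "crs_hom A M N h"
  shows "a \<in> Ob A \<Longrightarrow> x \<in> Val M a \<Longrightarrow> h a x \<in> Val N a"
    and "a \<in> Ob A \<Longrightarrow> x \<in> Val M a \<Longrightarrow> Str N a (h a x) = Str M a x"
    and "a \<in> Ob A \<Longrightarrow> x \<in> Val M a \<Longrightarrow> y \<in> Val M a \<Longrightarrow> h a (Mul M a x y) = Mul N a (h a x) (h a y)"
    and "a \<in> Ob A \<Longrightarrow> h a (One M a) = One N a"
    and "f \<in> Hom A a b \<Longrightarrow> x \<in> Val M b \<Longrightarrow> h a (Res M f x) = Res N f (h b x)"
  using assms by (auto simp: crs_hom_def)

lemma mon_map_iff: "mon_map A M N h \<longleftrightarrow> crs_hom A M N h"
  by (auto simp: mon_map_def crs_hom_def over_map_def psh_map_def hom_def)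

section \<open>The category of crossed monoids over \<open>G\<close>\<close>

context crossed_site
begin

lemma CrsMon_sel:
  "Ob (CrsMon A G) = {M. crossed_monoid A G M}"
  "Ide (CrsMon A G) M = (M, \<lambda>a\<in>Ob A. \<lambda>x\<in>Val M a. x, M)"
  "Comp (CrsMon A G) (N', k, P) (M, h, N) = (M, \<lambda>a\<in>Ob A. \<lambda>x\<in>Val M a. k a (h a x), P)"
  by (simp_all add: CrsMon_def mon_obj_iff)

lemma Hom_CrsMon_iff:
  "(M, h, N) \<in> Hom (CrsMon A G) M' N' \<longleftrightarrow> M = M' \<and> N = N' \<and> crossed_monoid A G M \<and>
    crossed_monoid A G N \<and> crs_hom A M N h \<and> h \<in> (\<Pi>\<^sub>E a\<in>Ob A. Val M a \<rightarrow>\<^sub>E Val N a)"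
  by (auto simp: Hom_def CrsMon_def mon_obj_iff mon_map_iff)

lemma Hom_CrsMonE:
  assumes "u \<in> Hom (CrsMon A G) M N"
  obtains h where "u = (M, h, N)" "crossed_monoid A G M" "crossed_monoid A G N"
    "crs_hom A M N h" "h \<in> (\<Pi>\<^sub>E a\<in>Ob A. Val M a \<rightarrow>\<^sub>E Val N a)"
  using assms by (auto simp: Hom_def CrsMon_def mon_obj_iff mon_map_iff)

text \<open>\<open>M\<close> is closed under multiplication, unit and restriction, so values outside
  its carriers never enter. A map can thus be replaced by its extensional version, the form required
  of arrows in \<open>CrsMon\<close>.\<close>

lemma crs_hom_cong:
  assumes "\<And>a x. a \<in> Ob A \<Longrightarrow> x \<in> Val M a \<Longrightarrow> h a x = k a x" and "crossed_monoid A G M"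
  shows "crs_hom A M N h \<longleftrightarrow> crs_hom A M N k"
proof -
  interpret M: crossed_monoid A G M by fact
  have "h a (Res M f x) = k a (Res M f x)" "h b x = k b x"
    if "f \<in> Hom A a b" "x \<in> Val M b" for f a b x
    using assms(1) that M.M.Res_Val Hom_Ob by blast+
  then show ?thesis
    unfolding crs_hom_def
    by (simp add: assms(1) M.Mul_Val M.One_Val cong: ball_cong)
qed

lemma crs_hom_Hom:
  assumes "crossed_monoid A G M" "crossed_monoid A G N" "crs_hom A M N h"
  shows "(M, \<lambda>a\<in>Ob A. \<lambda>x\<in>Val M a. h a x, N) \<in> Hom (CrsMon A G) M N"
  using assms crs_hom_cong[OF _ assms(1), of "\<lambda>a\<in>Ob A. \<lambda>x\<in>Val M a. h a x" h N]
  by (auto simp: Hom_CrsMon_iff crs_homD(1))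

lemma crs_hom_ident: "crs_hom A M M (\<lambda>a x. x)"
  by (auto simp: crs_hom_def)

lemma crs_hom_comp:
  assumes "crs_hom A M N h" "crs_hom A N P k"
  shows "crs_hom A M P (\<lambda>a x. k a (h a x))"
proof -
  note D = crs_homD[OF assms(1)] crs_homD[OF assms(2)]
  have "b \<in> Ob A" if "f \<in> Hom A a b" for f a b using Hom_Ob that by blast
  then show ?thesis by (simp add: crs_hom_def D)
qed

lemma Hom_CrsMon_eqI:
  assumes "(M, h, N) \<in> Hom (CrsMon A G) M N" "(M, k, N) \<in> Hom (CrsMon A G) M N"
    and "\<And>a x. a \<in> Ob A \<Longrightarrow> x \<in> Val M a \<Longrightarrow> h a x = k a x"
  shows "(M, h, N) = (M, k, N)"
proof -
  have "h \<in> (\<Pi>\<^sub>E a\<in>Ob A. Val M a \<rightarrow>\<^sub>E Val N a)" "k \<in> (\<Pi>\<^sub>E a\<in>Ob A. Val M a \<rightarrow>\<^sub>E Val N a)"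
    using assms(1,2) by (auto simp: Hom_CrsMon_iff)
  moreover from this have "h a = k a" if "a \<in> Ob A" for a
    using assms(3)[OF that] that
    by (intro PiE_ext[of "h a" "Val M a" "\<lambda>_. Val N a"]) (auto dest: PiE_mem)
  ultimately have "h = k" by (intro PiE_ext) auto
  then show ?thesis by simp
qed

lemma category_CrsMon: "category (CrsMon A G)"
proof
  fix f M N P Q g h
  assume f: "f \<in> Hom (CrsMon A G) M N" and g: "g \<in> Hom (CrsMon A G) N P"
    and h: "h \<in> Hom (CrsMon A G) P Q"
  show "Comp (CrsMon A G) h (Comp (CrsMon A G) g f) = Comp (CrsMon A G) (Comp (CrsMon A G) h g) f"
    using f g h
    by (elim Hom_CrsMonE) (auto simp: CrsMon_sel crs_homD(1) intro!: restrict_ext)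
next
  fix f M N P g
  assume f: "f \<in> Hom (CrsMon A G) M N" and g: "g \<in> Hom (CrsMon A G) N P"
  then show "Comp (CrsMon A G) g f \<in> Hom (CrsMon A G) M P"
    by (elim Hom_CrsMonE) (simp add: CrsMon_sel crs_hom_Hom crs_hom_comp)
next
  fix M assume "M \<in> Ob (CrsMon A G)"
  then show "Ide (CrsMon A G) M \<in> Hom (CrsMon A G) M M"
    by (simp add: CrsMon_sel crs_hom_Hom crs_hom_ident)
next
  fix f M N assume "f \<in> Hom (CrsMon A G) M N"
  then obtain h where h: "f = (M, h, N)" "crossed_monoid A G M" "crossed_monoid A G N"
    "crs_hom A M N h" "h \<in> (\<Pi>\<^sub>E a\<in>Ob A. Val M a \<rightarrow>\<^sub>E Val N a)"
    by (elim Hom_CrsMonE)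
  have f: "(M, h, N) \<in> Hom (CrsMon A G) M N" using h by (simp add: Hom_CrsMon_iff)
  have *: "(\<lambda>a\<in>Ob A. \<lambda>x\<in>Val M a. h a x) = h"
    using Hom_CrsMon_eqI[OF crs_hom_Hom[OF h(2-4)] f] by simp
  have "(\<lambda>a\<in>Ob A. \<lambda>x\<in>Val M a. h a ((\<lambda>a\<in>Ob A. \<lambda>x\<in>Val M a. x) a x))
      = (\<lambda>a\<in>Ob A. \<lambda>x\<in>Val M a. h a x)" by (auto intro!: restrict_ext)
  then show "Comp (CrsMon A G) f (Ide (CrsMon A G) M) = f"
    using * h(1) by (simp add: CrsMon_sel)
  have "(\<lambda>a\<in>Ob A. \<lambda>x\<in>Val M a. (\<lambda>a\<in>Ob A. \<lambda>x\<in>Val N a. x) a (h a x))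
      = (\<lambda>a\<in>Ob A. \<lambda>x\<in>Val M a. h a x)"
    using crs_homD(1)[OF h(4)] by (auto intro!: restrict_ext)
  then show "Comp (CrsMon A G) (Ide (CrsMon A G) N) f = f"
    using * h(1) by (simp add: CrsMon_sel)
qed (auto simp: CrsMon_def)

lemma CrsMon_iso:
  assumes u: "(M, h, N) \<in> Hom (CrsMon A G) M N"
    and bij: "\<And>a. a \<in> Ob A \<Longrightarrow> bij_betw (h a) (Val M a) (Val N a)"
  shows "is_iso (CrsMon A G) (M, h, N) M N"
proof -
  have M: "crossed_monoid A G M" and N: "crossed_monoid A G N" and h: "crs_hom A M N h"
    using u by (auto simp: Hom_CrsMon_iff)
  interpret M: crossed_monoid A G M by (fact M)
  interpret N: crossed_monoid A G N by (fact N)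
  note hD = crs_homD[OF h]
  define k where "k = (\<lambda>a. the_inv_into (Val M a) (h a))"
  have kh: "k a (h a x) = x" if "a \<in> Ob A" "x \<in> Val M a" for a x
    using bij[OF that(1)] that by (auto simp: k_def bij_betw_def the_inv_into_f_f)
  have ex: "\<exists>x\<in>Val M a. y = h a x" if "a \<in> Ob A" "y \<in> Val N a" for a y
    using bij[OF that(1)] that by (auto simp: bij_betw_def)
  have k: "crs_hom A N M k"
    unfolding crs_hom_def
  proof (intro conjI ballI allI)
    fix a y assume a: "a \<in> Ob A" and y: "y \<in> Val N a"
    obtain x where x: "x \<in> Val M a" "y = h a x" using ex[OF a y] by blast
    then show "k a y \<in> Val M a" "Str M a (k a y) = Str N a y" using a kh hD by auto
    fix z assume z: "z \<in> Val N a"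
    obtain w where w: "w \<in> Val M a" "z = h a w" using ex[OF a z] by blast
    then show "k a (Mul N a y z) = Mul M a (k a y) (k a z)"
      using x a kh hD(3)[OF a x(1) w(1)] kh[OF a M.Mul_Val[OF a x(1) w(1)]] by simp
  next
    fix a assume a: "a \<in> Ob A"
    show "k a (One N a) = One M a" using hD(4)[OF a] kh[OF a M.One_Val[OF a]] by simp
  next
    fix a b f y assume f: "f \<in> Hom A a b" and y: "y \<in> Val N b"
    have ab: "a \<in> Ob A" "b \<in> Ob A" using Hom_Ob f by blast+
    obtain x where x: "x \<in> Val M b" "y = h b x" using ex[OF ab(2) y] by blast
    show "k a (Res N f y) = Res M f (k b y)"
      using x hD(5)[OF f x(1)] kh[OF ab(1) M.M.Res_Val[OF f x(1)]] kh[OF ab(2) x(1)] by simp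
  qed
  have hk: "h a (k a y) = y" if "a \<in> Ob A" "y \<in> Val N a" for a y
    using ex[OF that] kh that by auto
  show ?thesis
    unfolding is_iso_def
  proof (intro conjI bexI)
    show "(N, \<lambda>a\<in>Ob A. \<lambda>x\<in>Val N a. k a x, M) \<in> Hom (CrsMon A G) N M"
      using crs_hom_Hom[OF N M k] .
  qed (use u hD kh hk crs_homD(1)[OF k] in \<open>auto simp: CrsMon_sel intro!: restrict_ext\<close>)
qed

end

section \<open>Submonoids, opposites and change of carriers\<close>

definition restrict_mon :: "('o, 'm, 'u, 'g) crs_mon \<Rightarrow> ('o \<Rightarrow> 'u set) \<Rightarrow> ('o, 'm, 'u, 'g) crs_mon" where
  "restrict_mon M S = M\<lparr>Val := S\<rparr>"

lemma restrict_mon_sel [simp]: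
  "Val (restrict_mon M S) = S" "Res (restrict_mon M S) = Res M" "Str (restrict_mon M S) = Str M"
  "Mul (restrict_mon M S) = Mul M" "One (restrict_mon M S) = One M"
  by (simp_all add: restrict_mon_def)

text \<open>The opposite of \<open>M\<close> with structure map \<open>x \<mapsto> p(x)\<^sup>-\<^sup>1\<close>; for a crossed group \<open>x \<mapsto> x\<^sup>-\<^sup>1\<close> is an
  isomorphism onto it.\<close>

definition opp_mon :: "('o, 'm) cat \<Rightarrow> ('o, 'm, 'g) crs_grp \<Rightarrow> ('o, 'm, 'u, 'g) crs_mon \<Rightarrow>
    ('o, 'm, 'u, 'g) crs_mon" where
  "opp_mon A G M =
    \<lparr> Val = Val M,
      Res = (\<lambda>f x. Res M (Act G (inv\<^bsub>Gp G (Cod A f)\<^esub> (Str M (Cod A f) x)) f) x),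
      Str = (\<lambda>a x. inv\<^bsub>Gp G a\<^esub> (Str M a x)), Mul = (\<lambda>a x y. Mul M a y x), One = One M \<rparr>"

lemma opp_mon_sel [simp]:
  "Val (opp_mon A G M) = Val M" "Str (opp_mon A G M) a x = inv\<^bsub>Gp G a\<^esub> (Str M a x)"
  "Mul (opp_mon A G M) a x y = Mul M a y x" "One (opp_mon A G M) = One M"
  by (simp_all add: opp_mon_def)

context crossed_monoid
begin

lemma crossed_monoid_restrict:
  assumes sub: "\<And>a. a \<in> Ob A \<Longrightarrow> S a \<subseteq> Val M a"
    and Res: "\<And>f a b x. f \<in> Hom A a b \<Longrightarrow> x \<in> S b \<Longrightarrow> Res M f x \<in> S a"
    and Mul: "\<And>a x y. a \<in> Ob A \<Longrightarrow> x \<in> S a \<Longrightarrow> y \<in> S a \<Longrightarrow> Mul M a x y \<in> S a"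
    and One: "\<And>a. a \<in> Ob A \<Longrightarrow> One M a \<in> S a"
  shows "crossed_monoid A G (restrict_mon M S)"
proof -
  have S: "x \<in> Val M a" if "a \<in> Ob A" "x \<in> S a" for a x using sub that by blast
  have S': "x \<in> Val M b" if "f \<in> Hom A a b" "x \<in> S b" for f a b x using S Hom_Ob that by blast
  show ?thesis
    by unfold_locales
      (auto simp: S S' Res Mul One Str_Val Str_Res Mul_assoc Mul_One One_Mul Str_Mul Str_One Res_One
        M.Res_Ide M.Res_Comp intro: Res_Mul)
qed

lemma Act_Str_Hom: "f \<in> Hom A a b \<Longrightarrow> x \<in> Val M b \<Longrightarrow> Act G (Str M b x) f \<in> Hom A a b"
  using Act_Hom Str_Val Hom_Ob by blast

lemma Act_Str_inverse:
  assumes f: "f \<in> Hom A a b" and x: "x \<in> Val M b" and y: "y \<in> Val M b"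
    and "Mul M b x y = One M b"
  shows "Act G (Str M b x) (Act G (Str M b y) f) = f"
  using Str_Mul[of b x y] Str_Val[of b] Str_One[of b] Act_GMul[OF f, of "Str M b x" "Str M b y"]
    Act_GOne[OF f] Hom_Ob[OF f] assms by simp

text \<open>Restrict x y = 1 along f, and y x = 1 along f^y. Since (f^y)^x = f by
  \<open>Act_Str_inverse\<close>, the same two elements occur in both products, in opposite
  orders.\<close>

lemma Res_inverse:
  assumes f: "f \<in> Hom A a b" and x: "x \<in> Val M b" and y: "y \<in> Val M b"
    and xy: "Mul M b x y = One M b" and yx: "Mul M b y x = One M b"
  shows "Mul M a (Res M (Act G (Str M b y) f) x) (Res M f y) = One M a"
    and "Mul M a (Res M f y) (Res M (Act G (Str M b y) f) x) = One M a"
  using Res_Mul[OF f x y] Res_Mul[OF Act_Str_Hom[OF f y] y x] Act_Str_inverse[OF f x y xy]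
    Res_One[OF f] Res_One[OF Act_Str_Hom[OF f y]] xy yx by simp_all

lemma crossed_monoid_units:
  "crossed_monoid A G (restrict_mon M (\<lambda>a. Units (Mn M a)))"
proof (rule crossed_monoid_restrict)
  fix a assume a: "a \<in> Ob A"
  interpret monoid "Mn M a" using monoid_Mn a .
  show "Units (Mn M a) \<subseteq> Val M a" by (auto simp: Units_def)
  show "One M a \<in> Units (Mn M a)" using Units_one_closed by simp
  show "Mul M a x y \<in> Units (Mn M a)" if "x \<in> Units (Mn M a)" "y \<in> Units (Mn M a)" for x y
    using Units_m_closed that by simp
next
  fix f a b x assume f: "f \<in> Hom A a b" and "x \<in> Units (Mn M b)"
  then obtain y where x: "x \<in> Val M b" and y: "y \<in> Val M b"
    and "Mul M b x y = One M b" "Mul M b y x = One M b"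
    by (auto simp: Units_def)
  \<comment> \<open>The inverse is the restriction of \<open>y\<close> not along \<open>f\<close>
    but along \<open>f\<close> twisted by \<open>x\<close>.\<close>
  then show "Res M f x \<in> Units (Mn M a)"
    using Res_inverse[OF f y x] M.Res_Val[OF f x] M.Res_Val[OF Act_Str_Hom[OF f x] y]
    by (auto simp: Units_def)
qed

lemma Res_opp:
  "f \<in> Hom A a b \<Longrightarrow> Res (opp_mon A G M) f x = Res M (Act G (ginv b (Str M b x)) f) x"
  using Cod_Hom by (auto simp: opp_mon_def)

lemma crossed_monoid_opp: "crossed_monoid A G (opp_mon A G M)"
proof -
  have V: "ginv a (Str M a x) \<in> Val G a" if "a \<in> Ob A" "x \<in> Val M a" for a x
    using that Str_Val ginv_Val by blast
  have Hm: "Act G (ginv b (Str M b x)) f \<in> Hom A a b" if "f \<in> Hom A a b" "x \<in> Val M b" for f a b x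
    using that V Act_Hom Hom_Ob by blast
  have Sr: "Str (opp_mon A G M) a (Res (opp_mon A G M) f x) = Res G f (ginv b (Str M b x))"
    if f: "f \<in> Hom A a b" and x: "x \<in> Val M b" for f a b x
    using that Str_Res[OF Hm[OF that] x] Res_ginv[OF f Str_Val] Hom_Ob by (simp add: Res_opp)
  show ?thesis
  proof
    fix f a b x assume f: "f \<in> Hom A a b" and x: "x \<in> Val (opp_mon A G M) b"
    then show "Res (opp_mon A G M) f x \<in> Val (opp_mon A G M) a"
      using M.Res_Val[OF Hm] by (simp add: Res_opp)
    show "Str (opp_mon A G M) a (Res (opp_mon A G M) f x) = Res G f (Str (opp_mon A G M) b x)"
      using Sr f x by simp
  next
    fix a x assume a: "a \<in> Ob A" and x: "x \<in> Val (opp_mon A G M) a"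
    then have "Act G (ginv a (Str M a x)) (Ide A a) = Ide A a" using Act_Ide V by simp
    then show "Res (opp_mon A G M) (Ide A a) x = x"
      using M.Res_Ide a x Res_opp[OF Ide_Hom] by simp
  next
    fix f a b g c x
    assume f: "f \<in> Hom A a b" and g: "g \<in> Hom A b c" and x: "x \<in> Val (opp_mon A G M) c"
    let ?p = "ginv c (Str M c x)"
    have x': "x \<in> Val M c" and c: "c \<in> Ob A" using x g Hom_Ob by auto
    let ?y = "Res M (Act G ?p g) x"
    have y: "?y \<in> Val M b" using M.Res_Val Hm g x' by blast
    have *: "ginv b (Str M b ?y) = Res G g ?p"
      using Sr[OF g x'] by (simp add: Res_opp[OF g])
    have "Act G ?p (Comp A g f) = Comp A (Act G ?p g) (Act G (Res G g ?p) f)"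
      using Act_Comp[OF f g V[OF c x']] .
    then show "Res (opp_mon A G M) (Comp A g f) x = Res (opp_mon A G M) f (Res (opp_mon A G M) g x)"
      using Res_opp[OF Comp_Hom[OF f g]] Res_opp[OF f] Res_opp[OF g]
        M.Res_Comp[OF Hm[OF f y] Hm[OF g x'] x'] * by simp
  next
    fix f a b x y
    assume f: "f \<in> Hom A a b" and x: "x \<in> Val (opp_mon A G M) b" and y: "y \<in> Val (opp_mon A G M) b"
    let ?p = "ginv b (Str M b x)" and ?q = "ginv b (Str M b y)"
    have x': "x \<in> Val M b" and y': "y \<in> Val M b" and b: "b \<in> Ob A" using x y f Hom_Ob by auto
    have Sx: "Str M b x \<in> Val G b" using Str_Val b x' .
    \<comment> \<open>Inversion in \<open>G\<close> reverses p(y) p(x), which matches the reversed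
      multiplication of the opposite.\<close>
    have "ginv b (Str M b (Mul M b y x)) = GMul G b ?p ?q"
      using Str_Mul[OF b y' x'] ginv_mult[OF b Str_Val Str_Val] b x' y' by simp
    then have "Res (opp_mon A G M) f (Mul M b y x) = Res M (Act G ?p (Act G ?q f)) (Mul M b y x)"
      using Act_GMul[OF f V V] b x' y' by (simp add: Res_opp[OF f])
    \<comment> \<open>The left factor \<open>y\<close> is restricted along an arrow twisted once
      more by p(x), and this cancels the p(x)^-1 in \<open>?p\<close>.\<close>
    also have "\<dots> = Mul M a (Res M (Act G ?q f) y) (Res M (Act G ?p (Act G ?q f)) x)"
      using Res_Mul[OF Hm[OF Hm] y' x'] f x' y' Act_Act_ginv[OF Hm[OF f y'] Sx] by simp
    finally show "Res (opp_mon A G M) f (Mul (opp_mon A G M) b x y) =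
        Mul (opp_mon A G M) a (Res (opp_mon A G M) (Act G (Str (opp_mon A G M) b y) f) x)
          (Res (opp_mon A G M) f y)"
      using Res_opp[OF f] Res_opp[OF Hm[OF f y']] by simp
  next
    fix f a b assume f: "f \<in> Hom A a b"
    then show "Res (opp_mon A G M) f (One (opp_mon A G M) b) = One (opp_mon A G M) a"
      using Hom_Ob[OF f] by (simp add: Res_opp Str_One ginv_GOne Act_GOne Res_One)
  qed (simp_all add: V Mul_Val One_Val Mul_assoc Mul_One One_Mul Str_Mul Str_One ginv_GOne ginv_mult
      Str_Val)
qed

end

text \<open>The adjunctions concern carriers in the one type \<open>'u\<close>, while kernel pairs
  consist of pairs and free monoids of lists. A copy along an injection \<open>e\<close>, the same
  in all degrees, brings these into \<open>'u\<close>.\<close>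

definition transport_mon :: "('o, 'm) cat \<Rightarrow> ('u \<Rightarrow> 'v) \<Rightarrow> ('o, 'm, 'u, 'g) crs_mon \<Rightarrow>
    ('o, 'm, 'v, 'g) crs_mon" where
  "transport_mon A e M = (let d = the_inv_into (\<Union>a\<in>Ob A. Val M a) e in
    \<lparr> Val = (\<lambda>a. e ` Val M a), Res = (\<lambda>f z. e (Res M f (d z))), Str = (\<lambda>a z. Str M a (d z)),
      Mul = (\<lambda>a z w. e (Mul M a (d z) (d w))), One = (\<lambda>a. e (One M a)) \<rparr>)"

lemma (in crossed_monoid)
  assumes e: "inj_on e (\<Union>a\<in>Ob A. Val M a)"
  shows crossed_monoid_transport: "crossed_monoid A G (transport_mon A e M)"
    and crs_hom_transport: "crs_hom A M (transport_mon A e M) (\<lambda>_. e)"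
    and crs_hom_transport_inv:
      "crs_hom A (transport_mon A e M) M (\<lambda>_. the_inv_into (\<Union>a\<in>Ob A. Val M a) e)"
proof -
  define d where "d = the_inv_into (\<Union>a\<in>Ob A. Val M a) e"
  have d [simp]: "d (e x) = x" if "a \<in> Ob A" "x \<in> Val M a" for a x
    unfolding d_def using the_inv_into_f_f[OF e] that by blast
  note sel = transport_mon_def[of A e M, folded d_def, unfolded Let_def]
  have hd: "a \<in> Ob A" "b \<in> Ob A" "x \<in> Val M b \<Longrightarrow> Res M f x \<in> Val M a" if "f \<in> Hom A a b" for f a b x
    using Hom_Ob that M.Res_Val by blast+
  have hd': "d (e x) = x" if "f \<in> Hom A a b" "x \<in> Val M b" for f a b x
    using hd that d by blast
  have dR: "d (e (Res M f x)) = Res M f x" if "f \<in> Hom A a b" "x \<in> Val M b" for f a b x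
    using hd that d by blast
  show "crossed_monoid A G (transport_mon A e M)"
  proof
    fix f a b g c x
    assume f: "f \<in> Hom A a b" and g: "g \<in> Hom A b c" and x: "x \<in> Val (transport_mon A e M) c"
    then obtain y where "x = e y" "y \<in> Val M c" by (auto simp: sel)
    then show "Res (transport_mon A e M) (Comp A g f) x =
        Res (transport_mon A e M) f (Res (transport_mon A e M) g x)"
      using M.Res_Comp[OF f g, of y] hd'[OF g] hd'[OF f hd(3)[OF g]] by (simp add: sel)
  next
    fix f a b x y
    assume f: "f \<in> Hom A a b" and x: "x \<in> Val (transport_mon A e M) b"
      and y: "y \<in> Val (transport_mon A e M) b"
    then obtain x' y' where x': "x = e x'" "x' \<in> Val M b" and y': "y = e y'" "y' \<in> Val M b"
      by (auto simp: sel)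
    note b = hd(2)[OF f]
    have f': "Act G (Str M b y') f \<in> Hom A a b" using Act_Str_Hom f y' by blast
    show "Res (transport_mon A e M) f (Mul (transport_mon A e M) b x y) =
        Mul (transport_mon A e M) a
          (Res (transport_mon A e M) (Act G (Str (transport_mon A e M) b y) f) x)
          (Res (transport_mon A e M) f y)"
      using x' y' Res_Mul[OF f x'(2) y'(2)] Mul_Val[OF b x'(2) y'(2)]
        d[OF b Mul_Val[OF b x'(2) y'(2)]] d[OF b x'(2)] d[OF b y'(2)]
        d[OF hd(1)[OF f] hd(3)[OF f y'(2)]] d[OF hd(1)[OF f] hd(3)[OF f' x'(2)]]
      by (simp add: sel)
  qed (auto simp: sel hd hd' dR Str_Val Str_Res Mul_Val One_Val Mul_assoc Mul_One One_Mul Str_Mul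
      Str_One Res_One M.Res_Ide)
  show "crs_hom A M (transport_mon A e M) (\<lambda>_. e)"
    by (auto simp: crs_hom_def sel hd')
  show "crs_hom A (transport_mon A e M) M (\<lambda>_. the_inv_into (\<Union>a\<in>Ob A. Val M a) e)"
    unfolding d_def[symmetric] by (auto simp: crs_hom_def sel hd hd' dR Mul_Val One_Val)
qed

section \<open>Base change\<close>

lemma pull_mon_sel [simp]:
  "Val (pull_mon \<phi> M) a = Val M (FOb \<phi> a)" "Res (pull_mon \<phi> M) f = Res M (FAr \<phi> f)"
  "Str (pull_mon \<phi> M) a = Str M (FOb \<phi> a)" "Mul (pull_mon \<phi> M) a = Mul M (FOb \<phi> a)"
  "One (pull_mon \<phi> M) a = One M (FOb \<phi> a)"
  by (simp_all add: pull_mon_def)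

lemma Mn_pull [simp]: "Mn (pull_mon \<phi> M) a = Mn M (FOb \<phi> a)"
  by (simp add: Mn_def)

section \<open>Pullback of the crossed group along \<phi>\<close>

locale base_change = A: category A + A': crossed_site A' G + is_functor A A' \<phi>
  for A :: "('o, 'm) cat" and A' :: "('o2, 'm2) cat" and \<phi> :: "('o, 'm, 'o2, 'm2) funct"
    and G :: "('o2, 'm2, 'g) crs_grp" +
  assumes faithful: "faithful A \<phi>" and stable: "stable_under A G \<phi>"
begin

abbreviation pG :: "('o, 'm, 'g) crs_grp" where "pG \<equiv> pull_grp A \<phi> G"

lemma pG_sel [simp]:
  "Val pG a = Val G (FOb \<phi> a)" "Res pG f = Res G (FAr \<phi> f)" "GMul pG a = GMul G (FOb \<phi> a)"
  "GOne pG a = GOne G (FOb \<phi> a)" "Gp pG a = Gp G (FOb \<phi> a)"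
  by (simp_all add: pull_grp_def Gp_def)

lemmas Hom_Ob = HomD[OF A.category_axioms]

lemma FAr_inj: "f \<in> Hom A a b \<Longrightarrow> g \<in> Hom A a b \<Longrightarrow> FAr \<phi> f = FAr \<phi> g \<Longrightarrow> f = g"
  using faithful Hom_Ob[of f a b] by (auto simp: faithful_def inj_on_def)

text \<open>Stability puts the twisted image of \<open>f\<close> into the image of the Hom-set, and
  by faithfulness \<open>the_inv_into\<close> picks its only preimage.\<close>

lemma
  assumes f: "f \<in> Hom A a b" and x: "x \<in> Val G (FOb \<phi> b)"
  shows pG_Act_Hom: "Act pG x f \<in> Hom A a b"
    and FAr_Act: "FAr \<phi> (Act pG x f) = Act G x (FAr \<phi> f)"
proof -
  have ab: "a \<in> Ob A" "b \<in> Ob A" "Dom A f = a" "Cod A f = b" using Hom_Ob f by auto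
  have inj: "inj_on (FAr \<phi>) (Hom A a b)" using faithful ab by (auto simp: faithful_def)
  have im: "Act G x (FAr \<phi> f) \<in> FAr \<phi> ` Hom A a b"
    using stable ab x f unfolding stable_under_def by blast
  have "Act pG x f = the_inv_into (Hom A a b) (FAr \<phi>) (Act G x (FAr \<phi> f))"
    by (simp add: pull_grp_def ab)
  then show "Act pG x f \<in> Hom A a b" "FAr \<phi> (Act pG x f) = Act G x (FAr \<phi> f)"
    using the_inv_into_into[OF inj im] f_the_inv_into_f[OF inj im] by auto
qed

text \<open>Equations between arrows are checked after applying \<phi>, where \<open>FAr_Act\<close>
  turns them into equations for \<open>G\<close>; \<open>FAr_inj\<close> reflects them because both
  sides are parallel.\<close>

lemma crossed_site_pull: "crossed_site A pG"
proof (intro crossed_site.intro crossed_group.intro presheaf.intro crossed_group_axioms.intro)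
  show "category A" by (fact A.category_axioms)
  show gp: "group (Gp pG a)" if "a \<in> Ob A" for a using A'.Gp_group FOb_Ob that by simp
  fix a b assume a: "a \<in> Ob A" and b: "b \<in> Ob A"
  note gb = gp[OF b]
  interpret group "Gp G (FOb \<phi> b)" using gb by simp
  show "group_action (Gp pG b) (Hom A a b) (\<lambda>x. restrict (Act pG x) (Hom A a b))"
  proof (rule actI[OF gb])
    fix f assume f: "f \<in> Hom A a b"
    have one: "GOne G (FOb \<phi> b) \<in> Val G (FOb \<phi> b)" using A'.GOne_Val FOb_Ob b by blast
    show "Act pG \<one>\<^bsub>Gp pG b\<^esub> f = f"
      using FAr_inj[OF pG_Act_Hom[OF f one] f] FAr_Act[OF f one] A'.Act_GOne[OF FAr_Hom[OF f]]
      by simp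
    fix x y assume "x \<in> carrier (Gp pG b)" "y \<in> carrier (Gp pG b)"
    then have x: "x \<in> Val G (FOb \<phi> b)" and y: "y \<in> Val G (FOb \<phi> b)" by auto
    have xy: "GMul G (FOb \<phi> b) x y \<in> Val G (FOb \<phi> b)" using A'.GMul_Val FOb_Ob b x y by blast
    show "Act pG (x \<otimes>\<^bsub>Gp pG b\<^esub> y) f = Act pG x (Act pG y f)"
      using FAr_inj[OF pG_Act_Hom[OF f xy] pG_Act_Hom[OF pG_Act_Hom[OF f y] x]] FAr_Act[OF f xy]
        FAr_Act[OF pG_Act_Hom[OF f y] x] FAr_Act[OF f y] A'.Act_GMul[OF FAr_Hom[OF f] x y]
      by simp
  qed (simp add: pG_Act_Hom)
next
  fix f a b g c x
  assume f: "f \<in> Hom A a b" and g: "g \<in> Hom A b c" and "x \<in> Val pG c"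
  then have x: "x \<in> Val G (FOb \<phi> c)" by simp
  have gx: "Res G (FAr \<phi> g) x \<in> Val G (FOb \<phi> b)" using A'.Res_Val FAr_Hom g x by blast
  note c = pG_Act_Hom[OF A.Comp_Hom[OF f g] x] A.Comp_Hom[OF pG_Act_Hom[OF f gx] pG_Act_Hom[OF g x]]
  show "Act pG x (Comp A g f) = Comp A (Act pG x g) (Act pG (Res pG g x) f)"
    using FAr_inj[OF c] FAr_Act[OF A.Comp_Hom[OF f g] x] FAr_Comp[OF f g] FAr_Act[OF f gx]
      FAr_Act[OF g x] FAr_Comp[OF pG_Act_Hom[OF f gx] pG_Act_Hom[OF g x]]
      A'.Act_Comp[OF FAr_Hom[OF f] FAr_Hom[OF g] x] by simp
next
  fix f a b x assume "f \<in> Hom A a b" "x \<in> Val pG b"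
  then show "Res pG f x \<in> Val pG a" using A'.Res_Val[OF FAr_Hom] by simp
next
  fix a x assume "a \<in> Ob A" "x \<in> Val pG a"
  then show "Res pG (Ide A a) x = x" using A'.Res_Ide FOb_Ob FAr_Ide by auto
next
  fix f a b g c x
  assume f: "f \<in> Hom A a b" and g: "g \<in> Hom A b c" and "x \<in> Val pG c"
  then show "Res pG (Comp A g f) x = Res pG f (Res pG g x)"
    using A'.Res_Comp[OF FAr_Hom[OF f] FAr_Hom[OF g]] FAr_Comp[OF f g] by simp
next
  fix f a b x y assume f: "f \<in> Hom A a b" and x: "x \<in> Val pG b" and y: "y \<in> Val pG b"
  then show "Res pG f (GMul pG b x y) = GMul pG a (Res pG (Act pG y f) x) (Res pG f y)"
    using A'.Res_GMul[OF FAr_Hom[OF f]] FAr_Act[OF f] by simp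
qed

sublocale pG: crossed_site A pG by (fact crossed_site_pull)

lemma crs_hom_pull:
  "crs_hom A' M N h \<Longrightarrow> crs_hom A (pull_mon \<phi> M) (pull_mon \<phi> N) (\<lambda>a. h (FOb \<phi> a))"
  by (simp add: crs_hom_def FOb_Ob crs_homD(5)[OF _ FAr_Hom])

lemma pull_functor_sel:
  "FOb (pull_functor A \<phi>) = pull_mon \<phi>"
  "FAr (pull_functor A \<phi>) (M, h, N) = (pull_mon \<phi> M, \<lambda>a\<in>Ob A. h (FOb \<phi> a), pull_mon \<phi> N)"
  by (simp_all add: pull_functor_def)

end

section \<open>The left adjoint preserves degreewise groups\<close>

locale flat_base_change = base_change A A' \<phi> G +
  adjunction "CrsMon A (pull_grp A \<phi> G)" "CrsMon A' G" Flat "pull_functor A \<phi>" \<eta> \<epsilon>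
  for A :: "('o, 'm) cat" and A' :: "('o2, 'm2) cat" and \<phi> :: "('o, 'm, 'o2, 'm2) funct"
    and G :: "('o2, 'm2, 'g) crs_grp"
    and Flat :: "(('o, 'm, 'u, 'g) crs_mon, ('o, 'm, 'u, 'g) crs_mon_arr,
      ('o2, 'm2, 'u, 'g) crs_mon, ('o2, 'm2, 'u, 'g) crs_mon_arr) funct"
    and \<eta> \<epsilon>
begin

sublocale adj: cat_adjunction "CrsMon A pG" "CrsMon A' G" Flat "pull_functor A \<phi>" \<eta> \<epsilon>
  by (intro cat_adjunction.intro adjunction_axioms pG.category_CrsMon A'.category_CrsMon)

lemma flat_group:
  assumes M: "crossed_monoid A pG M" and gr: "\<And>a. a \<in> Ob A \<Longrightarrow> group (Mn M a)"
    and b: "b \<in> Ob A'"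
  shows "group (Mn (FOb Flat M) b)"
proof -
  define N where "N = FOb Flat M"
  have MOb: "M \<in> Ob (CrsMon A pG)" using M by (simp add: pG.CrsMon_sel)
  have NOb: "N \<in> Ob (CrsMon A' G)" unfolding N_def using adj.L.FOb_Ob[OF MOb] .
  interpret M: crossed_monoid A pG M by (fact M)
  interpret N: crossed_monoid A' G N using NOb by (simp add: A'.CrsMon_sel)
  \<comment> \<open>The crossed submonoid of invertible elements, to be shown to exhaust
    \<open>N\<close>.\<close>
  define U where "U = restrict_mon N (\<lambda>a. Units (Mn N a))"
  have U: "crossed_monoid A' G U" unfolding U_def by (rule N.crossed_monoid_units)
  have UOb: "U \<in> Ob (CrsMon A' G)" using U by (simp add: A'.CrsMon_sel)
  have pU: "crossed_monoid A pG (pull_mon \<phi> U)"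
    using adj.R.FOb_Ob[OF UOb] by (simp add: pull_functor_sel pG.CrsMon_sel)
  have unit: "\<eta> M \<in> Hom (CrsMon A pG) M (pull_mon \<phi> N)"
    using unit_Hom[OF MOb] by (simp add: pull_functor_sel N_def)
  then obtain u where u: "\<eta> M = (M, u, pull_mon \<phi> N)" "crs_hom A M (pull_mon \<phi> N) u"
    "u \<in> (\<Pi>\<^sub>E a\<in>Ob A. Val M a \<rightarrow>\<^sub>E Val (pull_mon \<phi> N) a)"
    by (elim pG.Hom_CrsMonE) auto
  \<comment> \<open>Homomorphisms preserve inverses, so the unit of the adjunction at
    \<open>M\<close> factors through the pullback of \<open>U\<close>.\<close>
  have "u a x \<in> Units (Mn N (FOb \<phi> a))" if a: "a \<in> Ob A" and x: "x \<in> Val M a" for a x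
  proof -
    interpret group "Mn M a" using gr a .
    obtain y where y: "y \<in> Val M a" "Mul M a y x = One M a" "Mul M a x y = One M a"
      using l_inv_ex[of x] r_inv[of x] l_inv[of x] inv_closed[of x] x by auto
    then show ?thesis
      using crs_homD(1)[OF u(2) a x] crs_homD(1)[OF u(2) a y(1)] crs_homD(3)[OF u(2) a x y(1)]
        crs_homD(3)[OF u(2) a y(1) x] crs_homD(4)[OF u(2) a]
      by (auto simp: Units_def)
  qed
  then have "crs_hom A M (pull_mon \<phi> U) u"
    using u(2) by (auto simp: crs_hom_def U_def)
  then have u': "(M, \<lambda>a\<in>Ob A. \<lambda>x\<in>Val M a. u a x, pull_mon \<phi> U) \<in> Hom (CrsMon A pG) M (pull_mon \<phi> U)"
    using pG.crs_hom_Hom[OF M pU] by blast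
  then have "(M, \<lambda>a\<in>Ob A. \<lambda>x\<in>Val M a. u a x, pull_mon \<phi> U) \<in>
      Hom (CrsMon A pG) M (FOb (pull_functor A \<phi>) U)" by (simp add: pull_functor_sel)
  \<comment> \<open>\<open>g\<close> is the transpose of the factored unit.\<close>
  then obtain g where g: "g \<in> Hom (CrsMon A' G) N U"
    and gu: "Comp (CrsMon A pG) (FAr (pull_functor A \<phi>) g) (\<eta> M) =
      (M, \<lambda>a\<in>Ob A. \<lambda>x\<in>Val M a. u a x, pull_mon \<phi> U)"
    using adj.right_transpose[OF MOb UOb] adj.left_transpose_Hom[OF UOb] unfolding N_def by blast
  obtain h where h: "g = (N, h, U)" "crs_hom A' N U h" using g by (elim A'.Hom_CrsMonE)
  have hN: "crs_hom A' N N h" using h(2) crs_homD(1)[OF h(2)]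
    by (auto simp: crs_hom_def U_def Units_def)
  \<comment> \<open>The left side is \<open>g\<close> followed by the inclusion of \<open>U\<close>,
    which is given by the same functions. It agrees with the identity after composition with the
    unit, so \<open>unit_epi\<close> applies.\<close>
  have "(N, \<lambda>b\<in>Ob A'. \<lambda>x\<in>Val N b. h b x, N) = Ide (CrsMon A' G) N"
  proof (rule adj.unit_epi[OF MOb NOb])
    show "(N, \<lambda>b\<in>Ob A'. \<lambda>x\<in>Val N b. h b x, N) \<in> Hom (CrsMon A' G) (FOb Flat M) N"
      using A'.crs_hom_Hom[OF N.crossed_monoid_axioms N.crossed_monoid_axioms hN] by (simp add: N_def)
    show "Ide (CrsMon A' G) N \<in> Hom (CrsMon A' G) (FOb Flat M) N"
      using adj.D.Ide_Hom[OF NOb] by (simp add: N_def)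
    have "h (FOb \<phi> a) (u a x) = u a x" if a: "a \<in> Ob A" and x: "x \<in> Val M a" for a x
    proof -
      have "(\<lambda>a\<in>Ob A. \<lambda>x\<in>Val M a. (\<lambda>a\<in>Ob A. h (FOb \<phi> a)) a (u a x)) =
          (\<lambda>a\<in>Ob A. \<lambda>x\<in>Val M a. u a x)"
        using gu by (simp add: h(1) u(1) pull_functor_sel pG.CrsMon_sel)
      then have "(\<lambda>a\<in>Ob A. \<lambda>x\<in>Val M a. (\<lambda>a\<in>Ob A. h (FOb \<phi> a)) a (u a x)) a x =
          (\<lambda>a\<in>Ob A. \<lambda>x\<in>Val M a. u a x) a x" by simp
      then show ?thesis using a x by simp
    qed
    then show "Comp (CrsMon A pG) (FAr (pull_functor A \<phi>) (N, \<lambda>b\<in>Ob A'. \<lambda>x\<in>Val N b. h b x, N)) (\<eta> M)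
        = Comp (CrsMon A pG) (FAr (pull_functor A \<phi>) (Ide (CrsMon A' G) N)) (\<eta> M)"
      using crs_homD(1)[OF u(2)] FOb_Ob
      by (auto simp: A'.CrsMon_sel pG.CrsMon_sel pull_functor_sel u(1) intro!: restrict_ext)
  qed
  then have id: "(\<lambda>b\<in>Ob A'. \<lambda>x\<in>Val N b. h b x) = (\<lambda>b\<in>Ob A'. \<lambda>x\<in>Val N b. x)"
    by (simp add: A'.CrsMon_sel)
  have "h b x = x" if "x \<in> Val N b" for x
    using fun_cong[OF fun_cong[OF id, of b], of x] b that by simp
  \<comment> \<open>\<open>h\<close> fixes every element of \<open>N\<close> and takes values in
    \<open>U\<close>.\<close>
  then have "Val N b \<subseteq> Units (Mn N b)" using crs_homD(1)[OF h(2) b] by (force simp: U_def)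
  then show ?thesis
    using N.monoid_Mn[OF b] by (simp add: group_def group_axioms_def N_def)
qed

end

section \<open>Coding pairs, lists and arrows in the universe\<close>

lemma infinite_pair_inj:
  assumes "infinite (UNIV :: 'u set)"
  obtains e :: "'u \<times> 'u \<Rightarrow> 'u" where "inj e"
proof -
  obtain e :: "'u \<times> 'u \<Rightarrow> 'u" where "bij_betw e (UNIV \<times> UNIV) UNIV"
    using card_of_Times_same_infinite[OF assms] unfolding card_of_ordIso[symmetric] by blast
  then show ?thesis using that by (auto simp: bij_betw_def)
qed

text \<open>The code is recursive: \<open>s\<close> embeds the universe into the complement of
  \<open>z\<close>, so the code \<open>z\<close> of the empty list differs from all others, and head
  and tail can be read off because \<open>s\<close> and the pairing \<open>p\<close> are
  injective.\<close>

lemma infinite_list_inj: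
  assumes "infinite (UNIV :: 'u set)"
  obtains e :: "'u list \<Rightarrow> 'u" where "inj e"
proof -
  obtain p :: "'u \<times> 'u \<Rightarrow> 'u" where p: "inj p" using infinite_pair_inj[OF assms] .
  fix z :: 'u
  obtain s :: "'u \<Rightarrow> 'u" where "bij_betw s UNIV (UNIV - {z})" using infinite_imp_bij_betw[OF assms] by blast
  then have s: "inj s" and z: "z \<notin> range s" by (auto simp: bij_betw_def)
  define e where "e = rec_list z (\<lambda>x _ r. s (p (x, r)))"
  have e: "e [] = z" "e (x # xs) = s (p (x, e xs))" for x xs by (simp_all add: e_def)
  have "e xs = e ys \<Longrightarrow> xs = ys" for xs ys
  proof (induction xs arbitrary: ys)
    case Nil
    then show ?case using z by (cases ys) (auto simp: e)
  next
    case (Cons x xs)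
    obtain y ys' where ys: "ys = y # ys'"
      using Cons.prems z by (cases ys) (auto simp: e)
    then show ?case using Cons.prems Cons.IH[of ys'] by (simp add: e inj_eq[OF s] inj_eq[OF p])
  qed
  then show ?thesis using that by (auto simp: inj_def)
qed

text \<open>An arrow is coded by its indicator function on \<open>Ar A\<close> with two distinct
  values in \<open>'u\<close>; \<open>closed_universe\<close> embeds such functions into
  \<open>'u\<close>.\<close>

lemma closed_universe_inj:
  assumes "closed_universe TYPE('u) A"
  obtains j :: "'m \<Rightarrow> 'u" where "inj_on j (Ar (A :: ('o, 'm) cat))"
proof -
  obtain e :: "('m \<Rightarrow> 'u) \<Rightarrow> 'u" where e: "inj_on e (Ar A \<rightarrow>\<^sub>E UNIV)"
    using assms by (auto simp: closed_universe_def lepoll_def)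
  have inf: "infinite (UNIV :: 'u set)" using assms by (simp add: closed_universe_def)
  obtain c d :: 'u where cd: "c \<noteq> d" using inf by (metis (full_types) finite.simps UNIV_eq_I insertCI)
  define k where "k = (\<lambda>f. \<lambda>g\<in>Ar A. if g = f then c else d)"
  have "inj_on k (Ar A)"
  proof (rule inj_onI)
    fix f g assume "f \<in> Ar A" "g \<in> Ar A" "k f = k g"
    from fun_cong[OF this(3), of f] show "f = g" using \<open>f \<in> Ar A\<close> cd by (auto simp: k_def split: if_splits)
  qed
  moreover have "k ` Ar A \<subseteq> Ar A \<rightarrow>\<^sub>E UNIV" by (auto simp: k_def)
  ultimately have "inj_on (e \<circ> k) (Ar A)"
    using e by (intro comp_inj_on) (auto intro: inj_on_subset)
  then show ?thesis using that by blast
qed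

context crossed_monoid
begin

lemma
  assumes a: "a \<in> Ob A" and gr: "group (Mn M a)" and x: "x \<in> Val M a"
  shows inv_Val: "inv\<^bsub>Mn M a\<^esub> x \<in> Val M a"
    and Mul_inv: "Mul M a x (inv\<^bsub>Mn M a\<^esub> x) = One M a"
    and inv_Mul: "Mul M a (inv\<^bsub>Mn M a\<^esub> x) x = One M a"
  using group.inv_closed[OF gr, of x] group.l_inv[OF gr, of x] group.r_inv[OF gr, of x] x by auto

lemma Str_inv:
  assumes a: "a \<in> Ob A" and gr: "group (Mn M a)" and x: "x \<in> Val M a"
  shows "Str M a (inv\<^bsub>Mn M a\<^esub> x) = ginv a (Str M a x)"
proof -
  interpret group "Gp G a" using Gp_group a .
  note y = inv_Val[OF a gr x]
  show ?thesis
    using inv_equality[of "Str M a (inv\<^bsub>Mn M a\<^esub> x)" "Str M a x"] Str_Mul[OF a y x]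
      inv_Mul[OF a gr x] Str_One[OF a] Str_Val[OF a x] Str_Val[OF a y] by simp
qed

text \<open>The two restrictions are mutually inverse by \<open>Res_inverse\<close>. The twist is
  that of \<open>opp_mon\<close>, so inversion in a crossed group is compatible with restriction as
  a map from the opposite.\<close>

lemma Res_inv:
  assumes f: "f \<in> Hom A a b" and gr: "group (Mn M a)" "group (Mn M b)" and x: "x \<in> Val M b"
  shows "Res M f (inv\<^bsub>Mn M b\<^esub> x) = inv\<^bsub>Mn M a\<^esub> (Res M (Act G (ginv b (Str M b x)) f) x)"
proof -
  interpret group "Mn M a" by fact
  have b: "b \<in> Ob A" using Hom_Ob f by blast
  note y = inv_Val[OF b gr(2) x]
  show ?thesis
    using Res_inverse(2)[OF f x y Mul_inv[OF b gr(2) x] inv_Mul[OF b gr(2) x]]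
      inv_equality[of "Res M f (inv\<^bsub>Mn M b\<^esub> x)"] M.Res_Val[OF f y] Str_inv[OF b gr(2) x]
      M.Res_Val[OF Act_Str_Hom[OF f y] x] by simp
qed

lemma group_MnI:
  assumes a: "a \<in> Ob A" and "\<And>x. x \<in> Val M a \<Longrightarrow> t x \<in> Val M a"
    and "\<And>x. x \<in> Val M a \<Longrightarrow> Mul M a (t x) x = One M a"
    and "\<And>x. x \<in> Val M a \<Longrightarrow> Mul M a x (t x) = One M a"
  shows "group (Mn M a)"
  using monoid_Mn[OF a] assms by (force simp: group_def group_axioms_def Units_def)

end

section \<open>The right adjoint: transposes, separation and inverses\<close>

locale sharp_base_change = base_change A A' \<phi> G +
  adjunction "CrsMon A' G" "CrsMon A (pull_grp A \<phi> G)" "pull_functor A \<phi>" Sharp \<eta> \<epsilon>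
  for A :: "('o, 'm) cat" and A' :: "('o2, 'm2) cat" and \<phi> :: "('o, 'm, 'o2, 'm2) funct"
    and G :: "('o2, 'm2, 'g) crs_grp"
    and Sharp :: "(('o, 'm, 'u, 'g) crs_mon, ('o, 'm, 'u, 'g) crs_mon_arr,
      ('o2, 'm2, 'u, 'g) crs_mon, ('o2, 'm2, 'u, 'g) crs_mon_arr) funct"
    and \<eta> \<epsilon> +
  assumes infinite_universe: "infinite (UNIV :: 'u set)"
begin

sublocale adj: cat_adjunction "CrsMon A' G" "CrsMon A pG" "pull_functor A \<phi>" Sharp \<eta> \<epsilon>
  by (intro cat_adjunction.intro adjunction_axioms pG.category_CrsMon A'.category_CrsMon)

definition counit_map :: "('o, 'm, 'u, 'g) crs_mon \<Rightarrow> 'o \<Rightarrow> 'u \<Rightarrow> 'u" where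
  "counit_map M = fst (snd (\<epsilon> M))"

context
  fixes M :: "('o, 'm, 'u, 'g) crs_mon"
  assumes M: "crossed_monoid A pG M"
begin

interpretation M: crossed_monoid A pG M by (fact M)

lemma Ob_M: "M \<in> Ob (CrsMon A pG)"
  using M by (simp add: pG.CrsMon_sel)

abbreviation N :: "('o2, 'm2, 'u, 'g) crs_mon" where "N \<equiv> FOb Sharp M"

abbreviation cu :: "'o \<Rightarrow> 'u \<Rightarrow> 'u" where "cu \<equiv> counit_map M"

lemma sharp_Ob: "N \<in> Ob (CrsMon A' G)"
  using adj.R.FOb_Ob[OF Ob_M] .

lemma crossed_monoid_sharp: "crossed_monoid A' G N"
  using sharp_Ob by (simp add: A'.CrsMon_sel)

interpretation N: crossed_monoid A' G N by (fact crossed_monoid_sharp)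

lemma counit_eq: "\<epsilon> M = (pull_mon \<phi> N, cu, M)"
  and counit_Hom_pull: "(pull_mon \<phi> N, cu, M) \<in> Hom (CrsMon A pG) (pull_mon \<phi> N) M"
  and counit_hom: "crs_hom A (pull_mon \<phi> N) M cu"
proof -
  have "\<epsilon> M \<in> Hom (CrsMon A pG) (pull_mon \<phi> N) M"
    using counit_Hom[OF Ob_M] by (simp add: pull_functor_sel)
  moreover from this show "\<epsilon> M = (pull_mon \<phi> N, cu, M)"
    by (elim pG.Hom_CrsMonE) (simp add: counit_map_def)
  ultimately show "(pull_mon \<phi> N, cu, M) \<in> Hom (CrsMon A pG) (pull_mon \<phi> N) M" by simp
  then show "crs_hom A (pull_mon \<phi> N) M cu" by (simp add: pG.Hom_CrsMon_iff)
qed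

lemmas counit_homD = crs_homD[OF counit_hom, simplified]

lemma crossed_monoid_pull:
  fixes K :: "('o2, 'm2, 'u, 'g) crs_mon"
  assumes "crossed_monoid A' G K"
  shows "crossed_monoid A pG (pull_mon \<phi> K)"
  using adj.L.FOb_Ob[of K] assms by (simp add: A'.CrsMon_sel pG.CrsMon_sel pull_functor_sel)

text \<open>The existence half of the universal property of the counit, freed from arrow triples and
  extensionality; \<open>sharp_transpose_unique\<close> is the other half.\<close>

lemma sharp_transpose:
  fixes K :: "('o2, 'm2, 'u, 'g) crs_mon"
  assumes K: "crossed_monoid A' G K" and h: "crs_hom A (pull_mon \<phi> K) M h"
  shows "\<exists>k. crs_hom A' K N k \<and> (\<forall>a\<in>Ob A. \<forall>x\<in>Val K (FOb \<phi> a). cu a (k (FOb \<phi> a) x) = h a x)"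
proof -
  let ?h = "(pull_mon \<phi> K, \<lambda>a\<in>Ob A. \<lambda>x\<in>Val (pull_mon \<phi> K) a. h a x, M)"
  have KOb: "K \<in> Ob (CrsMon A' G)" using K by (simp add: A'.CrsMon_sel)
  have h': "?h \<in> Hom (CrsMon A pG) (FOb (pull_functor A \<phi>) K) M"
    using pG.crs_hom_Hom[OF crossed_monoid_pull[OF K] M h] by (simp add: pull_functor_sel)
  then obtain g where g: "g \<in> Hom (CrsMon A' G) K N"
    and eq: "Comp (CrsMon A pG) (\<epsilon> M) (FAr (pull_functor A \<phi>) g) = ?h"
    using adj.left_transpose[OF KOb Ob_M h'] adj.right_transpose_Hom[OF KOb h'] by blast
  obtain k where k: "g = (K, k, N)" "crs_hom A' K N k" using g by (elim A'.Hom_CrsMonE)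
  have eq': "(\<lambda>a\<in>Ob A. \<lambda>x\<in>Val K (FOb \<phi> a). cu a ((\<lambda>a\<in>Ob A. k (FOb \<phi> a)) a x)) =
      (\<lambda>a\<in>Ob A. \<lambda>x\<in>Val K (FOb \<phi> a). h a x)"
    using eq by (simp add: k counit_eq pull_functor_sel pG.CrsMon_sel)
  have "cu a (k (FOb \<phi> a) x) = h a x" if "a \<in> Ob A" "x \<in> Val K (FOb \<phi> a)" for a x
    using fun_cong[OF fun_cong[OF eq', of a], of x] that by simp
  then show ?thesis using k by blast
qed

lemma sharp_transpose_unique:
  fixes K :: "('o2, 'm2, 'u, 'g) crs_mon"
  assumes K: "crossed_monoid A' G K" and k: "crs_hom A' K N k" and l: "crs_hom A' K N l"
    and eq: "\<And>a x. a \<in> Ob A \<Longrightarrow> x \<in> Val K (FOb \<phi> a) \<Longrightarrow> cu a (k (FOb \<phi> a) x) = cu a (l (FOb \<phi> a) x)"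
    and b: "b \<in> Ob A'" and x: "x \<in> Val K b"
  shows "k b x = l b x"
proof -
  have KOb: "K \<in> Ob (CrsMon A' G)" using K by (simp add: A'.CrsMon_sel)
  note H = A'.crs_hom_Hom[OF K crossed_monoid_sharp]
  have "(K, \<lambda>b\<in>Ob A'. \<lambda>x\<in>Val K b. k b x, N) = (K, \<lambda>b\<in>Ob A'. \<lambda>x\<in>Val K b. l b x, N)"
  proof (rule adj.counit_mono[OF KOb Ob_M H[OF k] H[OF l]])
    show "Comp (CrsMon A pG) (\<epsilon> M) (FAr (pull_functor A \<phi>) (K, \<lambda>b\<in>Ob A'. \<lambda>x\<in>Val K b. k b x, N))
      = Comp (CrsMon A pG) (\<epsilon> M) (FAr (pull_functor A \<phi>) (K, \<lambda>b\<in>Ob A'. \<lambda>x\<in>Val K b. l b x, N))"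
      using eq FOb_Ob
      by (auto simp: counit_eq pull_functor_sel pG.CrsMon_sel intro!: restrict_ext)
  qed
  then have eq': "(\<lambda>b\<in>Ob A'. \<lambda>x\<in>Val K b. k b x) = (\<lambda>b\<in>Ob A'. \<lambda>x\<in>Val K b. l b x)" by simp
  show ?thesis using fun_cong[OF fun_cong[OF eq', of b], of x] b x by simp
qed

text \<open>\<open>K\<close> is replaced by its copy in \<open>'u\<close> along \<open>e\<close>,
  and the transpose found there is composed with \<open>e\<close>.\<close>

lemma sharp_transpose_embedded:
  fixes K :: "('o2, 'm2, 'v, 'g) crs_mon" and e :: "'v \<Rightarrow> 'u"
  assumes K: "crossed_monoid A' G K" and e: "inj_on e (\<Union>b\<in>Ob A'. Val K b)"
    and h: "crs_hom A (pull_mon \<phi> K) M h"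
  obtains k where "crs_hom A' K N k"
    and "\<And>a x. a \<in> Ob A \<Longrightarrow> x \<in> Val K (FOb \<phi> a) \<Longrightarrow> cu a (k (FOb \<phi> a) x) = h a x"
proof -
  interpret K: crossed_monoid A' G K by (fact K)
  define d where "d = the_inv_into (\<Union>b\<in>Ob A'. Val K b) e"
  let ?T = "transport_mon A' e K"
  note T = K.crossed_monoid_transport[OF e] K.crs_hom_transport[OF e]
    K.crs_hom_transport_inv[OF e, folded d_def]
  have "crs_hom A (pull_mon \<phi> ?T) M (\<lambda>a x. h a (d x))"
    using pG.crs_hom_comp[OF crs_hom_pull[OF T(3)] h] .
  then obtain k where k: "crs_hom A' ?T N k"
    and *: "\<forall>a\<in>Ob A. \<forall>x\<in>Val ?T (FOb \<phi> a). cu a (k (FOb \<phi> a) x) = h a (d x)"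
    using sharp_transpose[OF T(1)] by blast
  have "crs_hom A' K N (\<lambda>b x. k b (e x))" using A'.crs_hom_comp[OF T(2) k] .
  moreover have "cu a (k (FOb \<phi> a) (e x)) = h a x" if a: "a \<in> Ob A" and x: "x \<in> Val K (FOb \<phi> a)" for a x
  proof -
    have "e x \<in> Val ?T (FOb \<phi> a)" using crs_homD(1)[OF T(2)] FOb_Ob a x by blast
    moreover have "d (e x) = x"
      unfolding d_def using the_inv_into_f_f[OF e] FOb_Ob a x by blast
    ultimately show ?thesis using * a by simp
  qed
  ultimately show ?thesis using that by blast
qed

lemma sharp_transpose_unique_embedded:
  fixes K :: "('o2, 'm2, 'v, 'g) crs_mon" and e :: "'v \<Rightarrow> 'u"
  assumes K: "crossed_monoid A' G K" and e: "inj_on e (\<Union>b\<in>Ob A'. Val K b)"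
    and k: "crs_hom A' K N k" and l: "crs_hom A' K N l"
    and eq: "\<And>a x. a \<in> Ob A \<Longrightarrow> x \<in> Val K (FOb \<phi> a) \<Longrightarrow> cu a (k (FOb \<phi> a) x) = cu a (l (FOb \<phi> a) x)"
    and b: "b \<in> Ob A'" and x: "x \<in> Val K b"
  shows "k b x = l b x"
proof -
  interpret K: crossed_monoid A' G K by (fact K)
  define d where "d = the_inv_into (\<Union>b\<in>Ob A'. Val K b) e"
  let ?T = "transport_mon A' e K"
  note T = K.crossed_monoid_transport[OF e] K.crs_hom_transport[OF e]
    K.crs_hom_transport_inv[OF e, folded d_def]
  have "k b (d (e x)) = l b (d (e x))"
  proof (rule sharp_transpose_unique[OF T(1) A'.crs_hom_comp[OF T(3) k] A'.crs_hom_comp[OF T(3) l] _ b])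
    show "cu a (k (FOb \<phi> a) (d z)) = cu a (l (FOb \<phi> a) (d z))"
      if "a \<in> Ob A" "z \<in> Val ?T (FOb \<phi> a)" for a z
      using eq crs_homD(1)[OF T(3)] FOb_Ob that by blast
    show "e x \<in> Val ?T b" using crs_homD(1)[OF T(2) b x] .
  qed
  moreover have "d (e x) = x" unfolding d_def using the_inv_into_f_f[OF e] b x by blast
  ultimately show ?thesis by simp
qed

text \<open>Testing along all arrows from objects \<phi> a into \<open>b\<close> makes the relation
  between x and y stable under restriction and meaningful in degrees outside the image of \<phi>.
  Equality in \<open>G\<close> gives the pairs a single structure map, so that both projections are
  maps over \<open>G\<close>.\<close>

lemma sharp_separated:
  assumes b: "b \<in> Ob A'" and x: "x \<in> Val N b" and y: "y \<in> Val N b" and Str: "Str N b x = Str N b y"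
    and sep: "\<And>a f. a \<in> Ob A \<Longrightarrow> f \<in> Hom A' (FOb \<phi> a) b \<Longrightarrow> cu a (Res N f x) = cu a (Res N f y)"
  shows "x = y"
proof -
  define E where "E = (\<lambda>b. {(x, y). x \<in> Val N b \<and> y \<in> Val N b \<and> Str N b x = Str N b y \<and>
    (\<forall>a\<in>Ob A. \<forall>f\<in>Hom A' (FOb \<phi> a) b. cu a (Res N f x) = cu a (Res N f y))})"
  have ED: "x \<in> Val N b" "y \<in> Val N b" "Str N b x = Str N b y"
    "a \<in> Ob A \<Longrightarrow> f \<in> Hom A' (FOb \<phi> a) b \<Longrightarrow> cu a (Res N f x) = cu a (Res N f y)"
    if "(x, y) \<in> E b" for x y a b f using that by (auto simp: E_def)
  define K where "K = \<lparr> Val = E, Res = (\<lambda>f (x, y). (Res N f x, Res N f y)),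
    Str = (\<lambda>b (x, _ :: 'u). Str N b x), Mul = (\<lambda>b (x, y) (z, w). (Mul N b x z, Mul N b y w)),
    One = (\<lambda>b. (One N b, One N b)) \<rparr>"
  have K_sel [simp]: "Val K = E" "Res K f (x, y) = (Res N f x, Res N f y)"
    "Str K b (x, y) = Str N b x" "Mul K b (x, y) (z, w) = (Mul N b x z, Mul N b y w)"
    "One K b = (One N b, One N b)" for f x y b z w by (simp_all add: K_def)
  have E_Res: "(Res N f x, Res N f y) \<in> E b" if f: "f \<in> Hom A' b c" and xy: "(x, y) \<in> E c" for f b c x y
  proof -
    have "cu a (Res N g (Res N f x)) = cu a (Res N g (Res N f y))"
      if a: "a \<in> Ob A" and g: "g \<in> Hom A' (FOb \<phi> a) b" for a g
      using N.M.Res_Comp[OF g f, symmetric] ED[OF xy] a A'.Comp_Hom[OF g f] by simp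
    then show ?thesis
      using N.M.Res_Val[OF f] ED(1-3)[OF xy] N.Str_Res[OF f] by (auto simp: E_def)
  qed
  have E_Mul: "(Mul N b x z, Mul N b y w) \<in> E b"
    if b: "b \<in> Ob A'" and xy: "(x, y) \<in> E b" and zw: "(z, w) \<in> E b" for b x y z w
  proof -
    note V = ED(1-3)[OF xy] ED(1-3)[OF zw]
    have "cu a (Res N f (Mul N b x z)) = cu a (Res N f (Mul N b y w))"
      if a: "a \<in> Ob A" and f: "f \<in> Hom A' (FOb \<phi> a) b" for a f
    proof -
      \<comment> \<open>The two products twist \<open>f\<close> by \<open>z\<close> and by
        \<open>w\<close>. These have the same image in \<open>G\<close>, so one arrow
        \<open>?f\<close> serves for both, and the relation between \<open>x\<close> and
        \<open>y\<close> is used along it.\<close>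
      let ?f = "Act G (Str N b z) f"
      have f': "?f \<in> Hom A' (FOb \<phi> a) b" using N.Act_Str_Hom[OF f V(4)] .
      show ?thesis
        using N.Res_Mul[OF f V(1,4)] N.Res_Mul[OF f V(2,5)] V(6) ED(4)[OF xy a f'] ED(4)[OF zw a f]
          counit_homD(3)[OF a N.M.Res_Val[OF f' V(1)] N.M.Res_Val[OF f V(4)]]
          counit_homD(3)[OF a N.M.Res_Val[OF f' V(2)] N.M.Res_Val[OF f V(5)]] by simp
    qed
    then show ?thesis using V b N.Mul_Val N.Str_Mul by (simp add: E_def)
  qed
  have K: "crossed_monoid A' G K"
  proof
    fix f a b x y assume f: "f \<in> Hom A' a b" and x: "x \<in> Val K b" and y: "y \<in> Val K b"
    obtain x1 x2 y1 y2 where xy: "x = (x1, x2)" "y = (y1, y2)" "(x1, x2) \<in> E b" "(y1, y2) \<in> E b"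
      using x y by (cases x, cases y) auto
    note V = ED(1-3)[OF xy(3)] ED(1-3)[OF xy(4)]
    show "Res K f (Mul K b x y) = Mul K a (Res K (Act G (Str K b y) f) x) (Res K f y)"
      using N.Res_Mul[OF f V(1,4)] N.Res_Mul[OF f V(2,5)] V(6) by (simp add: xy)
  next
    fix f a b assume f: "f \<in> Hom A' a b"
    show "Res K f (One K b) = One K a" using N.Res_One[OF f] by simp
  next
    fix a assume a: "a \<in> Ob A'"
    show "One K a \<in> Val K a" using N.One_Val[OF a] N.Res_One by (auto simp: E_def)
  next
    fix f a b g c x assume f: "f \<in> Hom A' a b" and g: "g \<in> Hom A' b c" and "x \<in> Val K c"
    then show "Res K (Comp A' g f) x = Res K f (Res K g x)"
      using N.M.Res_Comp[OF f g] ED(1,2) by (cases x) auto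
  next
    fix f a b x assume f: "f \<in> Hom A' a b" and "x \<in> Val K b"
    then show "Str K a (Res K f x) = Res G f (Str K b x)"
      using N.Str_Res[OF f] ED(1) by (cases x) auto
  qed (use E_Res E_Mul ED(1,2) in \<open>auto simp: N.M.Res_Ide N.Str_Val N.Mul_assoc N.Mul_One N.One_Mul
      N.Str_Mul N.Str_One\<close>)
  obtain e :: "'u \<times> 'u \<Rightarrow> 'u" where e: "inj e" using infinite_pair_inj[OF infinite_universe] .
  have fst: "crs_hom A' K N (\<lambda>_. fst)"
    by (auto simp: crs_hom_def ED(1))
  have snd: "crs_hom A' K N (\<lambda>_. snd)"
    using ED(2,3) by (auto simp: crs_hom_def)
  have "fst (x, y) = snd (x, y)"
  proof (rule sharp_transpose_unique_embedded[OF K inj_on_subset[OF e subset_UNIV] fst snd _ b])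
    fix a z assume a: "a \<in> Ob A" and z: "z \<in> Val K (FOb \<phi> a)"
    obtain u v where uv: "z = (u, v)" "(u, v) \<in> E (FOb \<phi> a)" using z by (cases z) auto
    \<comment> \<open>Testing along the identity of \<phi> a gives the equality of counit values
      that uniqueness of transposes asks for.\<close>
    note i = A'.Ide_Hom[OF FOb_Ob[OF a]]
    show "cu a (fst z) = cu a (snd z)"
      using ED(4)[OF uv(2) a i] N.M.Res_Ide[OF FOb_Ob[OF a]] ED(1,2)[OF uv(2)] by (simp add: uv(1))
  next
    show "(x, y) \<in> Val K b" using x y Str sep by (simp add: E_def)
  qed
  then show ?thesis by simp
qed

lemma sharp_group:
  assumes gr: "\<And>a. a \<in> Ob A \<Longrightarrow> group (Mn M a)" and b: "b \<in> Ob A'"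
  shows "group (Mn N b)"
proof -
  let ?O = "opp_mon A' G N"
  let ?inv = "\<lambda>a x. inv\<^bsub>Mn M a\<^esub> (cu a x)"
  have cuV: "cu a x \<in> Val M a" if "a \<in> Ob A" "x \<in> Val N (FOb \<phi> a)" for a x
    using counit_homD(1) that .
  have SV: "A'.ginv b (Str N b x) \<in> Val G b" if "b \<in> Ob A'" "x \<in> Val N b" for b x
    using A'.ginv_Val N.Str_Val that by blast
  \<comment> \<open>Inversion in \<open>M\<close> reverses products, so it becomes multiplicative on
    the opposite of \<open>N\<close>. Its transpose \<open>t\<close> is the candidate for inversion
    in \<open>N\<close>.\<close>
  have "crs_hom A (pull_mon \<phi> ?O) M ?inv"
    unfolding crs_hom_def
  proof (intro conjI ballI allI)
    fix a x assume a: "a \<in> Ob A" and "x \<in> Val (pull_mon \<phi> ?O) a"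
    then have x: "x \<in> Val N (FOb \<phi> a)" by simp
    show "?inv a x \<in> Val M a" using M.inv_Val[OF a gr[OF a] cuV[OF a x]] .
    show "Str M a (?inv a x) = Str (pull_mon \<phi> ?O) a x"
      using M.Str_inv[OF a gr[OF a] cuV[OF a x]] counit_homD(2)[OF a x] by simp
    fix y assume "y \<in> Val (pull_mon \<phi> ?O) a"
    then have y: "y \<in> Val N (FOb \<phi> a)" by simp
    interpret group "Mn M a" using gr a .
    show "?inv a (Mul (pull_mon \<phi> ?O) a x y) = Mul M a (?inv a x) (?inv a y)"
      using counit_homD(3)[OF a y x] inv_mult_group[of "cu a y" "cu a x"] cuV a x y by simp
  next
    fix a assume a: "a \<in> Ob A"
    interpret group "Mn M a" using gr a .
    show "?inv a (One (pull_mon \<phi> ?O) a) = One M a" using counit_homD(4)[OF a] inv_one by simp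
  next
    fix a b f x assume f: "f \<in> Hom A a b" and "x \<in> Val (pull_mon \<phi> ?O) b"
    then have x: "x \<in> Val N (FOb \<phi> b)" by simp
    have ab: "a \<in> Ob A" "b \<in> Ob A" using Hom_Ob f by blast+
    let ?q = "A'.ginv (FOb \<phi> b) (Str N (FOb \<phi> b) x)"
    have q: "?q \<in> Val G (FOb \<phi> b)" using SV FOb_Ob ab x by blast
    \<comment> \<open>The twist by \<open>?q\<close> takes place in \<open>A'\<close>;
      \<open>FAr_Act\<close> lifts it to \<open>A\<close>, where naturality of the counit
      applies.\<close>
    have "?inv a (Res (pull_mon \<phi> ?O) f x) = inv\<^bsub>Mn M a\<^esub> (Res M (Act pG ?q f) (cu b x))"
      using N.Res_opp[OF FAr_Hom[OF f]] FAr_Act[OF f q] counit_homD(5)[OF pG_Act_Hom[OF f q] x] by simp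
    also have "\<dots> = Res M f (?inv b x)"
      using M.Res_inv[OF f gr[OF ab(1)] gr[OF ab(2)] cuV[OF ab(2) x]] counit_homD(2)[OF ab(2) x] by simp
    finally show "?inv a (Res (pull_mon \<phi> ?O) f x) = Res M f (?inv b x)" .
  qed
  then obtain t where t: "crs_hom A' ?O N t"
    and ct: "\<And>a x. a \<in> Ob A \<Longrightarrow> x \<in> Val N (FOb \<phi> a) \<Longrightarrow> cu a (t (FOb \<phi> a) x) = ?inv a x"
    using sharp_transpose[OF N.crossed_monoid_opp] unfolding opp_mon_sel by blast
  note tD = crs_homD[OF t, simplified]
  have cancel: "Mul M a (cu a (t (FOb \<phi> a) x)) (cu a x) = One M a"
    "Mul M a (cu a x) (cu a (t (FOb \<phi> a) x)) = One M a"
    if a: "a \<in> Ob A" and x: "x \<in> Val N (FOb \<phi> a)" for a x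
    using ct[OF a x] M.inv_Mul[OF a gr[OF a] cuV[OF a x]] M.Mul_inv[OF a gr[OF a] cuV[OF a x]]
    by simp_all
  have one: "cu a (Res N f (One N b)) = One M a" if "a \<in> Ob A" "f \<in> Hom A' (FOb \<phi> a) b" for a f
    using N.Res_One counit_homD(4) that by simp
  show ?thesis
  proof (rule N.group_MnI[OF b])
    fix x assume x: "x \<in> Val N b"
    let ?p = "Str N b x" and ?q = "A'.ginv b (Str N b x)"
    note p = N.Str_Val[OF b x] and q = SV[OF b x]
    show tx: "t b x \<in> Val N b" using tD(1)[OF b x] .
    note St = tD(2)[OF b x]
    have Rt: "Res N f (t b x) = t a (Res N (Act G ?q f) x)" if "f \<in> Hom A' a b" for f a
      using tD(5)[OF that x] N.Res_opp[OF that] by simp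
    show "Mul N b (t b x) x = One N b"
    proof (rule sharp_separated[OF b N.Mul_Val[OF b tx x] N.One_Val[OF b]])
      show "Str N b (Mul N b (t b x) x) = Str N b (One N b)"
        using N.Str_Mul[OF b tx x] St N.Str_One[OF b] A'.ginv_GMul[OF b p] by simp
      fix a f assume a: "a \<in> Ob A" and f: "f \<in> Hom A' (FOb \<phi> a) b"
      note Rx = N.M.Res_Val[OF f x]
      \<comment> \<open>The product twists \<open>f\<close> by \<open>?p\<close> and
        \<open>Rt\<close> twists by \<open>?q\<close>. The two cancel, so both factors come from
        \<open>Res N f x\<close>.\<close>
      have "Res N f (Mul N b (t b x) x) = Mul N (FOb \<phi> a) (t (FOb \<phi> a) (Res N f x)) (Res N f x)"
        using N.Res_Mul[OF f tx x] Rt[OF A'.Act_Hom[OF f p]] A'.Act_ginv_Act[OF f p] by simp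
      then show "cu a (Res N f (Mul N b (t b x) x)) = cu a (Res N f (One N b))"
        using counit_homD(3)[OF a tD(1)[OF FOb_Ob[OF a] Rx] Rx] cancel[OF a Rx] one[OF a f] by simp
    qed
    show "Mul N b x (t b x) = One N b"
    proof (rule sharp_separated[OF b N.Mul_Val[OF b x tx] N.One_Val[OF b]])
      show "Str N b (Mul N b x (t b x)) = Str N b (One N b)"
        using N.Str_Mul[OF b x tx] St N.Str_One[OF b] A'.GMul_ginv[OF b p] by simp
      fix a f assume a: "a \<in> Ob A" and f: "f \<in> Hom A' (FOb \<phi> a) b"
      \<comment> \<open>In this order the product twists \<open>f\<close> by the image of
        \<open>t b x\<close>, which is \<open>?q\<close>, and \<open>Rt\<close> twists the other
        factor equally. Both factors come from \<open>?x\<close>.\<close>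
      let ?x = "Res N (Act G ?q f) x"
      have Rx: "?x \<in> Val N (FOb \<phi> a)" using N.M.Res_Val[OF A'.Act_Hom[OF f q] x] .
      have "Res N f (Mul N b x (t b x)) = Mul N (FOb \<phi> a) ?x (t (FOb \<phi> a) ?x)"
        using N.Res_Mul[OF f x tx] Rt[OF f] St by simp
      then show "cu a (Res N f (Mul N b x (t b x))) = cu a (Res N f (One N b))"
        using counit_homD(3)[OF a Rx tD(1)[OF FOb_Ob[OF a] Rx]] cancel[OF a Rx] one[OF a f] by simp
    qed
  qed
qed

text \<open>By fullness every arrow from \<phi> a' to \<phi> a is some \<phi> g, so naturality of
  the counit expresses all the separating values of x through \<open>cu a x\<close>. The image in
  \<open>G\<close> is determined too, as the counit lies over it.\<close>

lemma counit_inj: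
  assumes ff: "fully_faithful A A' \<phi>" and a: "a \<in> Ob A"
  shows "inj_on (cu a) (Val N (FOb \<phi> a))"
proof (rule inj_onI)
  fix x y assume x: "x \<in> Val N (FOb \<phi> a)" and y: "y \<in> Val N (FOb \<phi> a)" and xy: "cu a x = cu a y"
  show "x = y"
  proof (rule sharp_separated[OF FOb_Ob[OF a] x y])
    show "Str N (FOb \<phi> a) x = Str N (FOb \<phi> a) y" using counit_homD(2)[OF a] x y xy by metis
    fix a' f assume a': "a' \<in> Ob A" and "f \<in> Hom A' (FOb \<phi> a') (FOb \<phi> a)"
    moreover have "FAr \<phi> ` Hom A a' a = Hom A' (FOb \<phi> a') (FOb \<phi> a)"
      using ff a a' by (simp add: fully_faithful_def bij_betw_def)
    ultimately obtain g where g: "g \<in> Hom A a' a" "f = FAr \<phi> g" by blast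
    then show "cu a' (Res N f x) = cu a' (Res N f y)"
      using counit_homD(5)[OF g(1)] x y xy by simp
  qed
qed

end

end

section \<open>Free crossed monoids\<close>

fun free_str :: "('o, 'm, 'g) crs_grp \<Rightarrow> ('o, 'm, 'u, 'g) over \<Rightarrow> 'o \<Rightarrow> 'u list \<Rightarrow> 'g" where
  "free_str G X b [] = GOne G b"
| "free_str G X b (x # xs) = GMul G b (Str X b x) (free_str G X b xs)"

text \<open>The form forced by \<open>Res_Mul\<close>: a word is its head times its tail, so the
  head is restricted along \<open>f\<close> twisted by the image of the tail in
  \<open>G\<close>.\<close>

fun free_res :: "('o, 'm) cat \<Rightarrow> ('o, 'm, 'g) crs_grp \<Rightarrow> ('o, 'm, 'u, 'g) over \<Rightarrow> 'm \<Rightarrow>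
    'u list \<Rightarrow> 'u list" where
  "free_res A G X f [] = []"
| "free_res A G X f (x # xs) =
    Res X (Act G (free_str G X (Cod A f) xs) f) x # free_res A G X f xs"

definition free_mon :: "('o, 'm) cat \<Rightarrow> ('o, 'm, 'g) crs_grp \<Rightarrow> ('o, 'm, 'u, 'g) over \<Rightarrow>
    ('o, 'm, 'u list, 'g) crs_mon" where
  "free_mon A G X = \<lparr> Val = (\<lambda>b. lists (Val X b)), Res = free_res A G X, Str = free_str G X,
    Mul = (\<lambda>b xs ys. xs @ ys), One = (\<lambda>b. []) \<rparr>"

lemma free_mon_sel [simp]:
  "Val (free_mon A G X) b = lists (Val X b)" "Res (free_mon A G X) = free_res A G X"
  "Str (free_mon A G X) = free_str G X" "Mul (free_mon A G X) b xs ys = xs @ ys"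
  "One (free_mon A G X) b = []"
  by (simp_all add: free_mon_def)

text \<open>By Yoneda, maps to \<open>G\<close> from the representable at \<open>c\<close>
  correspond to elements \<open>g\<close> of G(c); \<open>Str\<close> is the map for
  \<open>g\<close>.\<close>

definition repr_over :: "('o, 'm) cat \<Rightarrow> ('o, 'm, 'g) crs_grp \<Rightarrow> 'o \<Rightarrow> 'g \<Rightarrow> ('o, 'm, 'm, 'g) over"
  where "repr_over A G c g = \<lparr> Val = (\<lambda>b. Hom A b c), Res = (\<lambda>f k. Comp A k f),
    Str = (\<lambda>b k. Res G k g) \<rparr>"

lemma repr_over_sel [simp]:
  "Val (repr_over A G c g) b = Hom A b c" "Res (repr_over A G c g) f k = Comp A k f"
  "Str (repr_over A G c g) b k = Res G k g"
  by (simp_all add: repr_over_def)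

context crossed_site
begin

lemma free_str_Val:
  assumes "over_obj A G X" and "b \<in> Ob A" and "xs \<in> lists (Val X b)"
  shows "free_str G X b xs \<in> Val G b"
  using assms(3)
proof (induction xs)
  case (Cons x xs)
  moreover have "Str X b x \<in> Val G b" using assms(1,2) Cons.hyps
    by (auto simp: over_obj_def psh_map_def)
  ultimately show ?case using GMul_Val[OF assms(2)] by simp
qed (simp add: GOne_Val assms(2))

lemma crossed_monoid_free:
  assumes X: "over_obj A G X"
  shows "crossed_monoid A G (free_mon A G X)"
proof -
  interpret X: presheaf A X using X by (simp add: over_obj_def)
  have S_Val: "Str X b x \<in> Val G b" if "b \<in> Ob A" "x \<in> Val X b" for b x
    using X that by (auto simp: over_obj_def psh_map_def)
  have S_Res: "Str X a (Res X f x) = Res G f (Str X b x)" if "f \<in> Hom A a b" "x \<in> Val X b" for f a b x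
    using X that by (auto simp: over_obj_def psh_map_def)
  note F = free_str_Val[OF X]
  have aH: "Act G (free_str G X b xs) f \<in> Hom A a b"
    if "f \<in> Hom A a b" "xs \<in> lists (Val X b)" for f a b xs
    using Act_Hom[OF that(1) F] Hom_Ob[OF that(1)] that(2) by blast
  have res: "free_res A G X f (x # xs) = Res X (Act G (free_str G X b xs) f) x # free_res A G X f xs"
    if "f \<in> Hom A a b" for f a b x xs
    using Cod_Hom[OF that] by simp
  have res_Val: "free_res A G X f xs \<in> lists (Val X a)"
    if f: "f \<in> Hom A a b" and xs: "xs \<in> lists (Val X b)" for f a b xs
    using xs
  proof (induction xs)
    case (Cons x xs)
    then show ?case using X.Res_Val[OF aH[OF f Cons.hyps(2)] Cons.hyps(1)]
      by (simp add: res[OF f] del: free_res.simps(2))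
  qed simp
  \<comment> \<open>\<open>Res_GMul\<close> twists the restriction of the head's image by the image
    of the tail, just as \<open>free_res\<close> does with the head.\<close>
  have str_res: "free_str G X a (free_res A G X f xs) = Res G f (free_str G X b xs)"
    if f: "f \<in> Hom A a b" and xs: "xs \<in> lists (Val X b)" for f a b xs
    using xs
  proof (induction xs)
    case Nil
    then show ?case by (simp add: Res_GOne[OF f])
  next
    case (Cons x xs)
    have b: "b \<in> Ob A" using Hom_Ob f by blast
    show ?case
      using Cons S_Res[OF aH[OF f Cons.hyps(2)] Cons.hyps(1)]
        Res_GMul[OF f S_Val[OF b Cons.hyps(1)] F[OF b Cons.hyps(2)]]
      by (simp add: res[OF f] del: free_res.simps(2))
  qed
  have str_append: "free_str G X b (xs @ ys) = GMul G b (free_str G X b xs) (free_str G X b ys)"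
    if b: "b \<in> Ob A" and xs: "xs \<in> lists (Val X b)" and ys: "ys \<in> lists (Val X b)" for b xs ys
    using xs by (induction xs) (auto simp: GOne_GMul[OF b] F[OF b] ys GMul_assoc[OF b] S_Val[OF b])
  show ?thesis
  proof
    fix f a b xs assume f: "f \<in> Hom A a b" and xs: "xs \<in> Val (free_mon A G X) b"
    show "Res (free_mon A G X) f xs \<in> Val (free_mon A G X) a" using res_Val[OF f] xs by simp
    show "Str (free_mon A G X) a (Res (free_mon A G X) f xs) = Res G f (Str (free_mon A G X) b xs)"
      using str_res[OF f] xs by simp
  next
    fix a xs assume a: "a \<in> Ob A" and "xs \<in> Val (free_mon A G X) a"
    then have "xs \<in> lists (Val X a)" by simp
    then have "free_res A G X (Ide A a) xs = xs"
      by (induction xs)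
        (auto simp: res[OF Ide_Hom[OF a]] Act_Ide[OF a F[OF a]] X.Res_Ide[OF a] simp del: free_res.simps(2))
    then show "Res (free_mon A G X) (Ide A a) xs = xs" by simp
  next
    fix f a b g c xs
    assume f: "f \<in> Hom A a b" and g: "g \<in> Hom A b c" and "xs \<in> Val (free_mon A G X) c"
    then have "xs \<in> lists (Val X c)" by simp
    \<comment> \<open>\<open>Act_Comp\<close> splits the twist of the composite. What then twists
      \<open>f\<close> is the image of the tail restricted along \<open>g\<close>, which is the
      image of the restricted tail by \<open>str_res\<close>.\<close>
    then have "free_res A G X (Comp A g f) xs = free_res A G X f (free_res A G X g xs)"
    proof (induction xs)
      case (Cons x xs)
      have c: "c \<in> Ob A" using Hom_Ob g by blast
      show ?case
        using Cons Act_Comp[OF f g F[OF c Cons.hyps(2)]] str_res[OF g Cons.hyps(2)]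
          X.Res_Comp[OF aH[OF f res_Val[OF g Cons.hyps(2)]] aH[OF g Cons.hyps(2)] Cons.hyps(1)]
        by (simp add: res[OF f] res[OF g] res[OF Comp_Hom[OF f g]] del: free_res.simps(2))
    qed simp
    then show "Res (free_mon A G X) (Comp A g f) xs =
        Res (free_mon A G X) f (Res (free_mon A G X) g xs)" by simp
  next
    fix f a b xs ys
    assume f: "f \<in> Hom A a b" and "xs \<in> Val (free_mon A G X) b" and "ys \<in> Val (free_mon A G X) b"
    then have xs: "xs \<in> lists (Val X b)" and ys: "ys \<in> lists (Val X b)" by auto
    have b: "b \<in> Ob A" using Hom_Ob f by blast
    \<comment> \<open>What follows a letter of \<open>xs\<close> is the rest of \<open>xs\<close>
      and then \<open>ys\<close>; \<open>Act_GMul\<close> splits its twist into one by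
      \<open>ys\<close> followed by one by that rest.\<close>
    have "free_res A G X f (xs @ ys) =
        free_res A G X (Act G (free_str G X b ys) f) xs @ free_res A G X f ys"
      using xs
    proof (induction xs)
      case (Cons x xs)
      then show ?case
        using str_append[OF b Cons.hyps(2) ys] Act_GMul[OF f F[OF b Cons.hyps(2)] F[OF b ys]]
        by (simp add: res[OF f] res[OF aH[OF f ys]] del: free_res.simps(2))
    qed simp
    then show "Res (free_mon A G X) f (Mul (free_mon A G X) b xs ys) =
        Mul (free_mon A G X) a (Res (free_mon A G X) (Act G (Str (free_mon A G X) b ys) f) xs)
          (Res (free_mon A G X) f ys)" by simp
  qed (auto simp: F str_append)
qed

lemma over_obj_repr:
  assumes c: "c \<in> Ob A" and g: "g \<in> Val G c"
  shows "over_obj A G (repr_over A G c g)"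
proof -
  have "presheaf A (repr_over A G c g)"
    by unfold_locales (auto intro: Comp_Hom Comp_Ide Comp_assoc)
  then show ?thesis
    using Res_Val g Res_Comp by (auto simp: over_obj_def psh_map_def)
qed

end

context base_change
begin

text \<open>Words are multiplied out in \<open>M\<close>, as for ordinary free monoids in each
  degree; only compatibility with restriction involves the twist. The source is already pulled back,
  so the map can be transposed to the right adjoint.\<close>

lemma crs_hom_free:
  assumes X: "over_obj A' G X" and M: "crossed_monoid A pG M"
    and h: "\<And>a x. a \<in> Ob A \<Longrightarrow> x \<in> Val X (FOb \<phi> a) \<Longrightarrow> h a x \<in> Val M a"
    and Str_h: "\<And>a x. a \<in> Ob A \<Longrightarrow> x \<in> Val X (FOb \<phi> a) \<Longrightarrow> Str M a (h a x) = Str X (FOb \<phi> a) x"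
    and Res_h: "\<And>f a b x. f \<in> Hom A a b \<Longrightarrow> x \<in> Val X (FOb \<phi> b) \<Longrightarrow>
      h a (Res X (FAr \<phi> f) x) = Res M f (h b x)"
  shows "crs_hom A (pull_mon \<phi> (free_mon A' G X)) M
    (\<lambda>a xs. foldr (\<lambda>x. Mul M a (h a x)) xs (One M a))"
proof -
  interpret M: crossed_monoid A pG M by (fact M)
  let ?e = "\<lambda>a xs. foldr (\<lambda>x. Mul M a (h a x)) xs (One M a)"
  have V: "?e a xs \<in> Val M a" if a: "a \<in> Ob A" and xs: "xs \<in> lists (Val X (FOb \<phi> a))" for a xs
    using xs by (induction xs) (auto simp: M.One_Val[OF a] M.Mul_Val[OF a] h[OF a])
  have S: "Str M a (?e a xs) = free_str G X (FOb \<phi> a) xs"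
    if a: "a \<in> Ob A" and xs: "xs \<in> lists (Val X (FOb \<phi> a))" for a xs
    using xs by (induction xs) (simp_all add: M.Str_One[OF a] M.Str_Mul[OF a] h[OF a] Str_h[OF a] V[OF a])
  have app: "?e a (xs @ ys) = Mul M a (?e a xs) (?e a ys)"
    if a: "a \<in> Ob A" and xs: "xs \<in> lists (Val X (FOb \<phi> a))" and ys: "ys \<in> lists (Val X (FOb \<phi> a))"
    for a xs ys
    using xs
  proof (induction xs)
    case Nil
    then show ?case using M.One_Mul[OF a V[OF a ys]] by simp
  next
    case (Cons x xs)
    then show ?case
      using M.Mul_assoc[OF a h[OF a Cons.hyps(1)] V[OF a Cons.hyps(2)] V[OF a ys]] by simp
  qed
  have res: "?e a (free_res A' G X (FAr \<phi> f) xs) = Res M f (?e b xs)"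
    if f: "f \<in> Hom A a b" and xs: "xs \<in> lists (Val X (FOb \<phi> b))" for f a b xs
    using xs
  proof (induction xs)
    case Nil
    then show ?case using M.Res_One[OF f] by simp
  next
    case (Cons x xs)
    have b: "b \<in> Ob A" using Hom_Ob f by blast
    let ?g = "free_str G X (FOb \<phi> b) xs"
    have g: "?g \<in> Val G (FOb \<phi> b)"
      using A'.free_str_Val[OF X FOb_Ob[OF b] Cons.hyps(2)] .
    have "Res M f (?e b (x # xs)) = Mul M a (Res M (Act pG ?g f) (h b x)) (Res M f (?e b xs))"
      using M.Res_Mul[OF f h[OF b Cons.hyps(1)] V[OF b Cons.hyps(2)]] S[OF b Cons.hyps(2)] by simp
    \<comment> \<open>Compatibility of \<open>h\<close> is used along the twisted arrow, whose image
      under \<phi> is the arrow along which \<open>free_res\<close> restricts the head.\<close>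
    also have "Res M (Act pG ?g f) (h b x) = h a (Res X (Act G ?g (FAr \<phi> f)) x)"
      using Res_h[OF pG_Act_Hom[OF f g] Cons.hyps(1)] FAr_Act[OF f g] by simp
    finally show ?case using Cons.IH A'.Cod_Hom[OF FAr_Hom[OF f]] by simp
  qed
  show ?thesis
    using V S app res by (simp add: crs_hom_def del: foldr_append)
qed

end

section \<open>Invertibility of the counit for fully faithful \<phi>\<close>

context sharp_base_change
begin

text \<open>An element \<open>m\<close> of \<open>M(a)\<close> is hit by the transpose of the map that sends the generator \<open>id\<close> of
  the free crossed monoid on the representable \<open>\<A>'(-, \<phi> a)\<close> to \<open>m\<close>.\<close>

lemma counit_surj:
  fixes j :: "'m2 \<Rightarrow> 'u"
  assumes ff: "fully_faithful A A' \<phi>" and j: "inj_on j (Ar A')"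
    and M: "crossed_monoid A pG M" and c: "c \<in> Ob A" and m: "m \<in> Val M c"
  shows "m \<in> counit_map M c ` Val (FOb Sharp M) (FOb \<phi> c)"
proof -
  interpret M: crossed_monoid A pG M by (fact M)
  define X where "X = repr_over A' G (FOb \<phi> c) (Str M c m)"
  \<comment> \<open>The inverse of \<phi> on arrows into \<open>c\<close>. It identifies the
    pulled-back representable at \<phi> c with the representable at \<open>c\<close>, and
    \<open>h\<close> is the Yoneda map of \<open>m\<close>.\<close>
  define \<psi> where "\<psi> = (\<lambda>a. the_inv_into (Hom A a c) (FAr \<phi>))"
  define h where "h = (\<lambda>a k. Res M (\<psi> a k) m)"
  have X_sel [simp]: "Val X b = Hom A' b (FOb \<phi> c)" "Res X f k = Comp A' k f"
    "Str X b k = Res G k (Str M c m)" for b f k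
    by (simp_all add: X_def)
  have X: "over_obj A' G X"
    unfolding X_def using A'.over_obj_repr[OF FOb_Ob[OF c]] M.Str_Val[OF c m] by simp
  have \<psi>: "\<psi> a k \<in> Hom A a c" "FAr \<phi> (\<psi> a k) = k"
    if "a \<in> Ob A" "k \<in> Hom A' (FOb \<phi> a) (FOb \<phi> c)" for a k
  proof -
    have "inj_on (FAr \<phi>) (Hom A a c)" "FAr \<phi> ` Hom A a c = Hom A' (FOb \<phi> a) (FOb \<phi> c)"
      using ff that c by (simp_all add: fully_faithful_def bij_betw_def)
    then show "\<psi> a k \<in> Hom A a c" "FAr \<phi> (\<psi> a k) = k"
      using the_inv_into_into[of "FAr \<phi>" "Hom A a c" k] f_the_inv_into_f[of "FAr \<phi>" "Hom A a c" k] that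
      by (auto simp: \<psi>_def)
  qed
  have \<psi>_FAr: "\<psi> a (FAr \<phi> f) = f" if f: "f \<in> Hom A a c" for a f
    using FAr_inj[OF \<psi>(1) f \<psi>(2)] FAr_Hom[OF f] Hom_Ob[OF f] by blast
  let ?e = "\<lambda>a xs. foldr (\<lambda>x. Mul M a (h a x)) xs (One M a)"
  have hom: "crs_hom A (pull_mon \<phi> (free_mon A' G X)) M ?e"
  proof (rule crs_hom_free[OF X M])
    fix a k assume a: "a \<in> Ob A" and "k \<in> Val X (FOb \<phi> a)"
    then have k: "k \<in> Hom A' (FOb \<phi> a) (FOb \<phi> c)" by simp
    show "h a k \<in> Val M a" unfolding h_def using M.M.Res_Val[OF \<psi>(1)[OF a k] m] .
    show "Str M a (h a k) = Str X (FOb \<phi> a) k"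
      unfolding h_def using M.Str_Res[OF \<psi>(1)[OF a k] m] \<psi>(2)[OF a k] by simp
  next
    fix f a b k assume f: "f \<in> Hom A a b" and "k \<in> Val X (FOb \<phi> b)"
    then have k: "k \<in> Hom A' (FOb \<phi> b) (FOb \<phi> c)" by simp
    have b: "b \<in> Ob A" using Hom_Ob f by blast
    note \<psi>k = \<psi>[OF b k]
    have "Comp A' k (FAr \<phi> f) = FAr \<phi> (Comp A (\<psi> b k) f)"
      using FAr_Comp[OF f \<psi>k(1)] \<psi>k(2) by simp
    then show "h a (Res X (FAr \<phi> f) k) = Res M f (h b k)"
      using \<psi>_FAr[OF A.Comp_Hom[OF f \<psi>k(1)]] M.M.Res_Comp[OF f \<psi>k(1) m] by (simp add: h_def)
  qed
  obtain l :: "'u list \<Rightarrow> 'u" where l: "inj l" using infinite_list_inj[OF infinite_universe] .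
  \<comment> \<open>A word of arrows is coded letterwise by \<open>j\<close> as a list over
    \<open>'u\<close>, and then by \<open>l\<close> as an element of \<open>'u\<close>.\<close>
  have "inj_on (map j) (lists (Ar A'))"
    using inj_on_map_lists[OF j] .
  then have "inj_on (map j) (\<Union>b\<in>Ob A'. Val (free_mon A' G X) b)"
    by (rule inj_on_subset) (auto simp: Hom_def)
  then have e: "inj_on (l \<circ> map j) (\<Union>b\<in>Ob A'. Val (free_mon A' G X) b)"
    using l by (intro comp_inj_on) (auto intro: inj_on_subset)
  obtain k where k: "crs_hom A' (free_mon A' G X) (FOb Sharp M) k"
    and eq: "\<And>a xs. a \<in> Ob A \<Longrightarrow> xs \<in> Val (free_mon A' G X) (FOb \<phi> a) \<Longrightarrow>
      counit_map M a (k (FOb \<phi> a) xs) = ?e a xs"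
    using sharp_transpose_embedded[OF M A'.crossed_monoid_free[OF X] e hom] by blast
  note i = A.Ide_Hom[OF c]
  let ?i = "[Ide A' (FOb \<phi> c)]"
  have iV: "?i \<in> Val (free_mon A' G X) (FOb \<phi> c)" using A'.Ide_Hom[OF FOb_Ob[OF c]] by simp
  have "?e c ?i = m"
    using \<psi>_FAr[OF i] FAr_Ide[OF c] M.M.Res_Ide[OF c m] M.Mul_One[OF c m] by (simp add: h_def)
  then have "m = counit_map M c (k (FOb \<phi> c) ?i)" using eq[OF c iV] by simp
  then show ?thesis using crs_homD(1)[OF k FOb_Ob[OF c] iV] by blast
qed

lemma counit_iso:
  fixes j :: "'m2 \<Rightarrow> 'u"
  assumes ff: "fully_faithful A A' \<phi>" and j: "inj_on j (Ar A')"
    and M: "M \<in> Ob (CrsMon A pG)"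
  shows "is_iso (CrsMon A pG) (\<epsilon> M) (FOb (pull_functor A \<phi>) (FOb Sharp M)) M"
proof -
  have M': "crossed_monoid A pG M" using M by (simp add: pG.CrsMon_sel)
  have "bij_betw (counit_map M a) (Val (pull_mon \<phi> (FOb Sharp M)) a) (Val M a)" if a: "a \<in> Ob A" for a
    using counit_inj[OF M' ff a] counit_surj[OF ff j M' a] crs_homD(1)[OF counit_hom[OF M'] a]
    by (auto simp: bij_betw_def)
  then show ?thesis
    using pG.CrsMon_iso[OF counit_Hom_pull[OF M']] counit_eq[OF M'] by (simp add: pull_functor_sel)
qed

end

section \<open>Restriction of both adjunctions to crossed groups, and full faithfulness\<close>

theorem theorem5p14:
  fixes A :: "('o, 'm) cat" and A' :: "('o2, 'm2) cat"
    and \<phi> :: "('o, 'm, 'o2, 'm2) funct"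
    and G :: "('o2, 'm2, 'u) crs_grp"
    and Flat Sharp :: "(('o, 'm, 'u, 'u) crs_mon, ('o, 'm, 'u, 'u) crs_mon_arr,
      ('o2, 'm2, 'u, 'u) crs_mon, ('o2, 'm2, 'u, 'u) crs_mon_arr) funct"
  assumes "category A" and "category A'"
    and "closed_universe TYPE('u) A" and "closed_universe TYPE('u) A'"
    and "is_functor A A' \<phi>" and "faithful A \<phi>"
    and "crossed_group A' G" and "stable_under A G \<phi>"
    and flat_adj: "adjunction (CrsMon A (pull_grp A \<phi> G)) (CrsMon A' G)
      Flat (pull_functor A \<phi>) \<eta> \<epsilon>"
    and sharp_adj: "adjunction (CrsMon A' G) (CrsMon A (pull_grp A \<phi> G))
      (pull_functor A \<phi>) Sharp \<eta>' \<epsilon>'"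
  shows "adjunction (CrsGrp A (pull_grp A \<phi> G)) (CrsGrp A' G)
      Flat (pull_functor A \<phi>) \<eta> \<epsilon> \<and>
    adjunction (CrsGrp A' G) (CrsGrp A (pull_grp A \<phi> G))
      (pull_functor A \<phi>) Sharp \<eta>' \<epsilon>' \<and>
    (fully_faithful A A' \<phi> \<longrightarrow>
      fully_faithful (CrsMon A (pull_grp A \<phi> G)) (CrsMon A' G) Flat \<and>
      fully_faithful (CrsMon A (pull_grp A \<phi> G)) (CrsMon A' G) Sharp \<and>
      fully_faithful (CrsGrp A (pull_grp A \<phi> G)) (CrsGrp A' G) Flat \<and>
      fully_faithful (CrsGrp A (pull_grp A \<phi> G)) (CrsGrp A' G) Sharp)"
proof -
  interpret base_change A A' \<phi> G
    using assms by (simp add: base_change_def base_change_axioms_def crossed_site_def)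
  interpret flat: flat_base_change A A' \<phi> G Flat \<eta> \<epsilon>
    by (intro flat_base_change.intro base_change_axioms flat_adj)
  interpret sharp: sharp_base_change A A' \<phi> G Sharp \<eta>' \<epsilon>'
    using assms(3) by (intro sharp_base_change.intro sharp_base_change_axioms.intro base_change_axioms
        sharp_adj) (simp add: closed_universe_def)
  obtain j :: "'m2 \<Rightarrow> 'u" where j: "inj_on j (Ar A')" using closed_universe_inj[OF assms(4)] .
  let ?S = "{M. \<forall>a\<in>Ob A. group (Mn M a)}" and ?T = "{M. \<forall>a\<in>Ob A'. group (Mn M a)}"
  have flat: "FOb Flat M \<in> ?T" if "M \<in> Ob (CrsMon A pG)" "M \<in> ?S" for M
    using flat.flat_group that by (simp add: pG.CrsMon_sel)
  have sharp: "FOb Sharp M \<in> ?T" if "M \<in> Ob (CrsMon A pG)" "M \<in> ?S" for M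
    using sharp.sharp_group that by (simp add: pG.CrsMon_sel)
  \<comment> \<open>The monoid of the pullback in degree a is that of \<open>M\<close> in degree
    \<phi> a.\<close>
  have pull: "FOb (pull_functor A \<phi>) M \<in> ?S" if "M \<in> ?T" for M :: "('o2, 'm2, 'u, 'u) crs_mon"
    using that FOb_Ob by (simp add: pull_functor_sel)
  have "adjunction (CrsGrp A pG) (CrsGrp A' G) Flat (pull_functor A \<phi>) \<eta> \<epsilon>"
    unfolding CrsGrp_def
    by (rule adjunction_full_subcat[OF flat_adj pG.category_CrsMon A'.category_CrsMon flat pull])
  moreover have "adjunction (CrsGrp A' G) (CrsGrp A pG) (pull_functor A \<phi>) Sharp \<eta>' \<epsilon>'"
    unfolding CrsGrp_def
    by (rule adjunction_full_subcat[OF sharp_adj A'.category_CrsMon pG.category_CrsMon pull sharp])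
  moreover have "fully_faithful (CrsMon A pG) (CrsMon A' G) Flat \<and>
      fully_faithful (CrsMon A pG) (CrsMon A' G) Sharp"
    if ff: "fully_faithful A A' \<phi>"
  proof
    note iso = sharp.counit_iso[OF ff j]
    show "fully_faithful (CrsMon A pG) (CrsMon A' G) Sharp"
      by (rule sharp.adj.fully_faithful_right[OF iso])
    \<comment> \<open>Inverting the counit of the right adjoint also inverts the unit of the left
      adjoint, so no description of \<open>Flat\<close> is called for.\<close>
    show "fully_faithful (CrsMon A pG) (CrsMon A' G) Flat"
      by (rule flat.adj.fully_faithful_left, rule unit_iso_of_counit_iso[OF
            flat.adj.cat_adjunction_axioms sharp.adj.cat_adjunction_axioms iso])
  qed
  moreover have "fully_faithful (CrsGrp A pG) (CrsGrp A' G) F"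
    if "fully_faithful (CrsMon A pG) (CrsMon A' G) F"
      and "\<And>M. M \<in> Ob (CrsMon A pG) \<Longrightarrow> M \<in> ?S \<Longrightarrow> FOb F M \<in> ?T"
    for F :: "(('o, 'm, 'u, 'u) crs_mon, ('o, 'm, 'u, 'u) crs_mon_arr,
      ('o2, 'm2, 'u, 'u) crs_mon, ('o2, 'm2, 'u, 'u) crs_mon_arr) funct"
    unfolding CrsGrp_def by (rule fully_faithful_full_subcat[OF that])
  ultimately show ?thesis using flat sharp by blast
qed

end
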